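(* Let $V$ be a finite ground set of $n$ items partitioned into $m$ groups $V_1,\dots,V_m$, let $k_i=|V_i|$ and $k_{\min}=\min_{i\in[m]}k_i$, let $\alpha$ be a nonnegative integer, and let $f:2^V\to\mathbb{R}_{\ge 0}$ be a (not necessarily monotone) submodular function. Let $OPT$ be an optimal solution of Problem P.0: maximize $f(S)$ over $S\subseteq V$ subject to $|S\cap V_i|-|S\cap V_j|\le\alpha$ for all $i,j\in[m]$. Suppose $k_{\min}>1$ and the algorithm SG (described in the context) is run with sampling probability $p=\frac{\sqrt5-1}{4}$. Then its output satisfies $$\mathbb{E}[f(A^{\mathsf{final}})]\ge 0.045\cdot f(OPT),$$ where the expectation is over the random set $R$ sampled by the algorithm.
   Context: For $X,Y\subseteq V$, $f(X\mid Y)=f(X\cup Y)-f(Y)$; $f$ is submodular if $f(e\mid Y)\le f(e\mid X)$ whenever $X\subseteq Y\subseteq V$ and $e\in V\setminus Y$. For each $i\in[m]$ let $r_i=\min\{\lfloor k_i/2\rfloor,\lfloor k_{\min}/2\rfloor+\alpha\}$. A set $S\subseteq V$ is called semi-feasible if $|S\cap V_i|\le r_i$ for all $i\in[m]$. Algorithm SG with parameter $p\in[0,1]$: (1) Sample a random set $R\subseteq V$ containing each item independently with probability $p$. (2) Greedy phase: start with $A=\emptyset$; repeatedly let $e'$ be an item maximizing $f(e\mid A)$ over all $e\in R\setminus A$ such that $A\cup\{e\}$ is semi-feasible (ties broken arbitrarily); if such $e'$ exists and $f(e'\mid A)>0$, add $e'$ to $A$, otherwise stop. Call the resulting set $A^{\mathsf{greedy}}$.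 (3) Completion phase: let $L=\{i\in[m]: |A^{\mathsf{greedy}}\cap V_i|<r_i\}$. For each $i\in L$ choose arbitrary disjoint sets $X_i,Y_i\subseteq V_i\setminus A^{\mathsf{greedy}}$ with $|X_i|=|Y_i|=r_i-|A^{\mathsf{greedy}}\cap V_i|$ (such sets always exist). Let $A^1=A^{\mathsf{greedy}}\cup\bigcup_{i\in L}X_i$, $A^2=A^{\mathsf{greedy}}\cup\bigcup_{i\in L}Y_i$, and output $A^{\mathsf{final}}$, the one of $A^1,A^2$ with larger $f$-value. *)

theory Defs
  imports Complex_Main
begin

definition is_partition :: "'a set \<Rightarrow> nat \<Rightarrow> (nat \<Rightarrow> 'a set) \<Rightarrow> bool" where
  "is_partition V m G \<longleftrightarrow>
     (\<Union>i<m. G i) = V \<and> (\<forall>i<m. \<forall>j<m. i \<noteq> j \<longrightarrow> G i \<inter> G j = {}) \<and> (\<forall>i<m. G i \<noteq> {})"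

definition submodular_on :: "'a set \<Rightarrow> ('a set \<Rightarrow> real) \<Rightarrow> bool" where
  "submodular_on V f \<longleftrightarrow>
     (\<forall>X Y e. X \<subseteq> Y \<and> Y \<subseteq> V \<and> e \<in> V - Y \<longrightarrow>
        f (Y \<union> {e}) - f Y \<le> f (X \<union> {e}) - f X)"

definition kmin :: "nat \<Rightarrow> (nat \<Rightarrow> 'a set) \<Rightarrow> nat" where
  "kmin m G = Min ((\<lambda>i. card (G i)) ` {..<m})"

definition rcap :: "nat \<Rightarrow> (nat \<Rightarrow> 'a set) \<Rightarrow> nat \<Rightarrow> nat \<Rightarrow> nat" where
  "rcap m G \<alpha> i = min (card (G i) div 2) (kmin m G div 2 + \<alpha>)"

definition semi_feasible :: "nat \<Rightarrow> (nat \<Rightarrow> 'a set) \<Rightarrow> nat \<Rightarrow> 'a set \<Rightarrow> bool" where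
  "semi_feasible m G \<alpha> S \<longleftrightarrow> (\<forall>i<m. card (S \<inter> G i) \<le> rcap m G \<alpha> i)"

definition fair_feasible :: "nat \<Rightarrow> (nat \<Rightarrow> 'a set) \<Rightarrow> nat \<Rightarrow> 'a set \<Rightarrow> bool" where
  "fair_feasible m G \<alpha> S \<longleftrightarrow>
     (\<forall>i<m. \<forall>j<m. int (card (S \<inter> G i)) - int (card (S \<inter> G j)) \<le> int \<alpha>)"

(* sets reachable by the greedy phase on sample R (any tie-breaking) *)
inductive greedy_reach :: "nat \<Rightarrow> (nat \<Rightarrow> 'a set) \<Rightarrow> nat \<Rightarrow> ('a set \<Rightarrow> real) \<Rightarrow> 'a set \<Rightarrow> 'a set \<Rightarrow> bool"
  for m G \<alpha> f R where
  start: "greedy_reach m G \<alpha> f R {}"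
| step: "\<lbrakk> greedy_reach m G \<alpha> f R A;
           e \<in> R - A; semi_feasible m G \<alpha> (A \<union> {e});
           \<forall>e'\<in>R - A. semi_feasible m G \<alpha> (A \<union> {e'}) \<longrightarrow> f (A \<union> {e'}) - f A \<le> f (A \<union> {e}) - f A;
           f (A \<union> {e}) - f A > 0 \<rbrakk>
         \<Longrightarrow> greedy_reach m G \<alpha> f R (A \<union> {e})"

definition greedy_result :: "nat \<Rightarrow> (nat \<Rightarrow> 'a set) \<Rightarrow> nat \<Rightarrow> ('a set \<Rightarrow> real) \<Rightarrow> 'a set \<Rightarrow> 'a set \<Rightarrow> bool" where
  "greedy_result m G \<alpha> f R A \<longleftrightarrow> greedy_reach m G \<alpha> f R A \<and>
     (\<forall>e\<in>R - A. semi_feasible m G \<alpha> (A \<union> {e}) \<longrightarrow> f (A \<union> {e}) - f A \<le> 0)"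

definition SG_output :: "nat \<Rightarrow> (nat \<Rightarrow> 'a set) \<Rightarrow> nat \<Rightarrow> ('a set \<Rightarrow> real) \<Rightarrow> 'a set \<Rightarrow> 'a set \<Rightarrow> bool" where
  "SG_output m G \<alpha> f R Afin \<longleftrightarrow>
     (\<exists>Ag X Y. greedy_result m G \<alpha> f R Ag \<and>
        (let L = {i. i < m \<and> card (Ag \<inter> G i) < rcap m G \<alpha> i};
             A1 = Ag \<union> (\<Union>i\<in>L. X i);
             A2 = Ag \<union> (\<Union>i\<in>L. Y i) in
          (\<forall>i\<in>L. X i \<subseteq> G i - Ag \<and> Y i \<subseteq> G i - Ag \<and> X i \<inter> Y i = {} \<and>
                  card (X i) = rcap m G \<alpha> i - card (Ag \<inter> G i) \<and>
                  card (Y i) = rcap m G \<alpha> i - card (Ag \<inter> G i)) \<and>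
          (Afin = A1 \<or> Afin = A2) \<and> f Afin = max (f A1) (f A2)))"

(* expectation over R, each element of V included independently with prob p *)
definition sample_expect :: "'a set \<Rightarrow> real \<Rightarrow> ('a set \<Rightarrow> real) \<Rightarrow> real" where
  "sample_expect V p g = (\<Sum>R\<in>Pow V. p ^ card R * (1 - p) ^ (card V - card R) * g R)"

end

theory Submission
  imports Defs "HOL-Library.FuncSet" "HOL-Library.Disjoint_Sets"
begin

text \<open>
  Write \<open>C\<close> for the optimum, \<open>p\<close> for the sampling rate and \<open>A R\<close> for the greedy set of the sample
  \<open>R\<close>. The completion phase loses a factor 2, so it suffices that \<open>\<E> f(A R) \<ge> 0.09 f C\<close>.
  Ties may be broken depending on all of \<open>R\<close>, so the usual argument that simulates sampling during
  the run of the greedy phase is not available. We only use that every \<open>x \<in> R\<close> in a saturated group \<open>i\<close> has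
  marginal at most \<open>h i\<close>, a lower bound on the gains of the items selected in the group, and that it
  has nonpositive marginal in an unsaturated group. Hence
  \<open>f(A \<union> T) \<le> f A + (\<Sum>i. card (T \<inter> G i - A) * h i)\<close> for \<open>T \<subseteq> R \<inter> C\<close>. Conversely, if each item of \<open>C\<close>
  lies in \<open>T\<close> with probability at least \<open>t\<close> and \<open>T\<close> depends on \<open>R \<inter> C\<close> only, then
  \<open>\<E> f(A \<union> T) \<ge> (1 - p) t f C\<close>, because an item outside \<open>C\<close> belongs to \<open>A\<close> with probability at most \<open>p\<close>.

  If \<open>C\<close> can be cut into blocks of size at most 2 (or of size 5, using two units of capacity, or of size 3
  filling a whole group), one block per unit of capacity, then thinning \<open>R \<inter> C\<close> blockwise bounds the charge by \<open>f A\<close> with \<open>t = p - p\<^sup>2/2\<close>, which is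
  just enough. Otherwise every group has capacity 1 and meets \<open>C\<close> in exactly 3 items. Then we
  take three samples that agree outside \<open>C\<close> and are pairwise disjoint inside \<open>C\<close>, and bound \<open>f\<close> on the union
  of the three greedy sets: a group saturated in several copies by items outside \<open>C\<close> costs only the
  minimum of the gains beyond the first copy, and this minimum is charged to the copy with the fewest
  sampled items of \<open>C\<close> in the group, where the other charges are small.
\<close>

section \<open>Submodular functions\<close>

text \<open>The random set contains each item with probability between \<open>\<mu>\<close> and
  \<open>q\<close>, with arbitrary correlations. Order the items by decreasing probability: each
  gains at least as much on top of the random set restricted to its predecessors as on top of all
  its predecessors, and summation by parts gives the bound. It is applied once with
  \<open>\<mu> = 0\<close> and once with \<open>q = 1\<close>.\<close>

lemma random_subset_bound:
  fixes g :: "'a set \<Rightarrow> real" and w :: "'i \<Rightarrow> real"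
  assumes "finite N" "\<And>i. i \<in> I \<Longrightarrow> 0 \<le> w i" "sum w I = 1"
    and nonneg: "\<And>X. X \<subseteq> N \<Longrightarrow> 0 \<le> g X"
    and lattice: "\<And>X Y. X \<subseteq> N \<Longrightarrow> Y \<subseteq> N \<Longrightarrow> g (X \<union> Y) + g (X \<inter> Y) \<le> g X + g Y"
    and upper: "\<And>v. v \<in> N \<Longrightarrow> (\<Sum>i\<in>I. w i * of_bool (v \<in> S i)) \<le> q"
    and lower: "\<And>v. v \<in> N \<Longrightarrow> \<mu> \<le> (\<Sum>i\<in>I. w i * of_bool (v \<in> S i))"
    and "\<And>i. i \<in> I \<Longrightarrow> S i \<subseteq> N" "0 \<le> \<mu>" "\<mu> \<le> q"
  shows "(1 - q) * g {} + \<mu> * g N \<le> (\<Sum>i\<in>I. w i * g (S i))"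
proof -
  define mass where "mass v = (\<Sum>i\<in>I. w i * of_bool (v \<in> S i))" for v
  \<comment> \<open>The threshold is quantified inside, so that the induction hypothesis can be
    applied with the probability of the new item.\<close>
  have "M \<subseteq> N \<longrightarrow> (\<forall>\<mu>. 0 \<le> \<mu> \<and> \<mu> \<le> q \<and> (\<forall>v\<in>M. \<mu> \<le> mass v) \<longrightarrow>
      (1 - q) * g {} + \<mu> * g M \<le> (\<Sum>i\<in>I. w i * g (S i \<inter> M)))" if "finite M" for M
    using that
  \<comment> \<open>Ranking by the negated probability makes the inserted item the least likely one,
    so its probability is an admissible threshold for the items before it.\<close>
  proof (induction rule: finite_ranking_induct[where f = "\<lambda>v. - mass v"])
    case empty
    have "(1 - q) * g {} + \<mu> * g {} \<le> g {}" if "\<mu> \<le> q" for \<mu>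
      using mult_right_mono[OF that nonneg[of "{}"]] by (simp add: algebra_simps)
    then show ?case
      using \<open>sum w I = 1\<close> by (auto simp flip: sum_distrib_right)
  next
    case (insert x M)
    show ?case
    proof (cases "x \<in> M")
      case True
      then show ?thesis using insert.IH by (simp add: insert_absorb)
    next
      case False
      show ?thesis
      proof (intro impI allI, elim conjE)
        fix \<mu> assume sub: "insert x M \<subseteq> N" and \<mu>: "0 \<le> \<mu>" "\<mu> \<le> q" "\<forall>v\<in>insert x M. \<mu> \<le> mass v"
        have "0 \<le> mass x" "mass x \<le> q"
          using assms(2) upper[of x] sub by (auto simp: mass_def intro!: sum_nonneg)
        then have IH: "(1 - q) * g {} + mass x * g M \<le> (\<Sum>i\<in>I. w i * g (S i \<inter> M))"
          using insert.IH insert.hyps(2) sub by auto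
        \<comment> \<open>Lattice submodularity for \<open>S i \<inter> insert x M\<close> and
          \<open>M\<close>: the gain of \<open>x\<close> over the smaller set dominates its gain
          over \<open>M\<close>.\<close>
        have step: "g (S i \<inter> M) + of_bool (x \<in> S i) * (g (insert x M) - g M) \<le> g (S i \<inter> insert x M)" for i
        proof (cases "x \<in> S i")
          case True
          have "(S i \<inter> insert x M) \<union> M = insert x M" "(S i \<inter> insert x M) \<inter> M = S i \<inter> M"
            using True False by auto
          then show ?thesis
            using lattice[of "S i \<inter> insert x M" M] True sub by (simp add: le_infI2)
        qed auto
        have "(1 - q) * g {} + \<mu> * g (insert x M) \<le> (1 - q) * g {} + mass x * g (insert x M)"
          using \<mu> nonneg[OF sub] by (simp add: mult_right_mono)
        also have "\<dots> \<le> (\<Sum>i\<in>I. w i * g (S i \<inter> M)) + mass x * (g (insert x M) - g M)"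
          using IH by (simp add: algebra_simps)
        also have "\<dots> = (\<Sum>i\<in>I. w i * (g (S i \<inter> M) + of_bool (x \<in> S i) * (g (insert x M) - g M)))"
          by (simp add: mass_def sum_distrib_right distrib_left sum.distrib mult.assoc)
        also have "\<dots> \<le> (\<Sum>i\<in>I. w i * g (S i \<inter> insert x M))"
          by (intro sum_mono mult_left_mono step assms(2))
        finally show "(1 - q) * g {} + \<mu> * g (insert x M) \<le> (\<Sum>i\<in>I. w i * g (S i \<inter> insert x M))" .
      qed
    qed
  qed
  from this[OF \<open>finite N\<close>] have "(1 - q) * g {} + \<mu> * g N \<le> (\<Sum>i\<in>I. w i * g (S i \<inter> N))"
    using assms lower by (auto simp: mass_def)
  moreover have "S i \<inter> N = S i" if "i \<in> I" for i using assms(8)[OF that] by auto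
  ultimately show ?thesis by simp
qed

locale submodular =
  fixes V :: "'a set" and f :: "'a set \<Rightarrow> real"
  assumes finite_ground: "finite V"
    and nonneg: "\<And>S. S \<subseteq> V \<Longrightarrow> 0 \<le> f S"
    and submodular: "submodular_on V f"
begin

definition marg :: "'a \<Rightarrow> 'a set \<Rightarrow> real" where
  "marg e X = f (insert e X) - f X"

lemma marg_mem [simp]: "e \<in> X \<Longrightarrow> marg e X = 0"
  by (simp add: marg_def insert_absorb)

lemma marg_antimono: "X \<subseteq> Y \<Longrightarrow> Y \<subseteq> V \<Longrightarrow> e \<in> V \<Longrightarrow> e \<notin> Y \<Longrightarrow> marg e Y \<le> marg e X"
  using submodular unfolding submodular_on_def marg_def
  by (metis Diff_iff Un_commute insert_is_Un)

lemma diminishing_returns: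
  assumes "W \<subseteq> X" "X \<subseteq> V" "Z \<subseteq> V" "X \<inter> Z \<subseteq> W"
  shows "f (X \<union> Z) - f X \<le> f (W \<union> Z) - f W"
proof -
  have "finite Z" using assms(3) finite_ground finite_subset by blast
  then show ?thesis using assms(3,4)
  proof (induction Z)
    case (insert z Z)
    have IH: "f (X \<union> Z) - f X \<le> f (W \<union> Z) - f W" using insert by auto
    show ?case
    proof (cases "z \<in> X")
      case True
      then have "z \<in> W" using insert.prems by auto
      then show ?thesis using True IH by (simp add: insert_absorb)
    next
      case False
      then have "marg z (X \<union> Z) \<le> marg z (W \<union> Z)"
        using insert assms by (intro marg_antimono) auto
      then show ?thesis using IH by (simp add: marg_def)
    qed
  qed simp
qed

lemma lattice_submodular:
  assumes "X \<subseteq> V" "Y \<subseteq> V"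
  shows "f (X \<union> Y) + f (X \<inter> Y) \<le> f X + f Y"
proof -
  have "X \<inter> Y \<union> Y = Y" by auto
  then show ?thesis using diminishing_returns[of "X \<inter> Y" X Y] assms by auto
qed

lemma union_le_sum_marg:
  assumes "X \<subseteq> V" "T \<subseteq> V"
  shows "f (X \<union> T) \<le> f X + (\<Sum>e\<in>T. marg e X)"
proof -
  have "finite T" using assms(2) finite_ground finite_subset by blast
  then show ?thesis using assms(2)
  proof (induction T)
    case (insert e T)
    have "marg e (X \<union> T) \<le> marg e X"
    proof (cases "e \<in> X")
      case False
      then show ?thesis using insert assms by (intro marg_antimono) auto
    qed simp
    then show ?case using insert by (simp add: marg_def)
  qed simp
qed

text \<open>Partial minimisation over an interval of sets preserves submodularity: union and
  intersection of two minimisers are again admissible, and since \<open>B1\<close>,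
  \<open>B2\<close> avoid \<open>C\<close>, both lattice operations split into a part inside and a
  part outside \<open>C\<close>. The minimum later removes the uncontrolled dependence of the greedy
  set inside \<open>C\<close> on the colours outside.\<close>

lemma union_min_submodular:
  assumes disj: "B1 \<inter> C = {}" "B2 \<inter> C = {}" and sub: "B1 \<subseteq> V" "B2 \<subseteq> V" "T \<subseteq> C" "C \<subseteq> V"
  defines "g \<equiv> \<lambda>B. Min ((\<lambda>Q. f (Q \<union> B)) ` {Q. T \<subseteq> Q \<and> Q \<subseteq> C})"
  shows "g (B1 \<union> B2) + g (B1 \<inter> B2) \<le> g B1 + g B2"
proof -
  have fin: "finite {Q. T \<subseteq> Q \<and> Q \<subseteq> C}"
    using finite_subset[OF \<open>C \<subseteq> V\<close> finite_ground] by simp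
  have ne: "{Q. T \<subseteq> Q \<and> Q \<subseteq> C} \<noteq> {}" using sub by auto
  have attained: "\<exists>Q. T \<subseteq> Q \<and> Q \<subseteq> C \<and> g B = f (Q \<union> B)" for B
  proof -
    have "g B \<in> (\<lambda>Q. f (Q \<union> B)) ` {Q. T \<subseteq> Q \<and> Q \<subseteq> C}"
      unfolding g_def using fin ne by (intro Min_in) auto
    then show ?thesis by blast
  qed
  obtain Q1 Q2 where Q: "T \<subseteq> Q1" "Q1 \<subseteq> C" "g B1 = f (Q1 \<union> B1)"
      "T \<subseteq> Q2" "Q2 \<subseteq> C" "g B2 = f (Q2 \<union> B2)"
    using attained[of B1] attained[of B2] by blast
  have le: "g B \<le> f (Q \<union> B)" if "T \<subseteq> Q" "Q \<subseteq> C" for Q B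
    unfolding g_def using fin that by (intro Min_le) auto
  have eq: "(Q1 \<union> B1) \<inter> (Q2 \<union> B2) = (Q1 \<inter> Q2) \<union> (B1 \<inter> B2)" "(Q1 \<union> B1) \<union> (Q2 \<union> B2) = (Q1 \<union> Q2) \<union> (B1 \<union> B2)"
    using Q(2,5) disj by blast+
  have "g (B1 \<union> B2) + g (B1 \<inter> B2) \<le> f ((Q1 \<union> Q2) \<union> (B1 \<union> B2)) + f ((Q1 \<inter> Q2) \<union> (B1 \<inter> B2))"
    using Q by (intro add_mono le) auto
  also have "\<dots> \<le> f (Q1 \<union> B1) + f (Q2 \<union> B2)"
    using lattice_submodular[of "Q1 \<union> B1" "Q2 \<union> B2"] Q sub unfolding eq by auto
  finally show ?thesis using Q by simp
qed

end

section \<open>Random colourings\<close>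

text \<open>Expectation under the product measure in which \<open>v\<close> gets colour
  \<open>c\<close> with probability \<open>q v c\<close>. One such space carries several coupled
  copies of the sample.\<close>

definition colour_expect :: "('a \<Rightarrow> nat \<Rightarrow> real) \<Rightarrow> 'a set \<Rightarrow> (('a \<Rightarrow> nat) \<Rightarrow> real) \<Rightarrow> real" where
  "colour_expect q V \<phi> = (\<Sum>\<omega>\<in>PiE V (\<lambda>_. {..<5}). (\<Prod>v\<in>V. q v (\<omega> v)) * \<phi> \<omega>)"

definition colour_weights :: "('a \<Rightarrow> nat \<Rightarrow> real) \<Rightarrow> 'a set \<Rightarrow> bool" where
  "colour_weights q V \<longleftrightarrow> (\<forall>v\<in>V. (\<forall>c. 0 \<le> q v c) \<and> (\<Sum>c<5. q v c) = 1)"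

lemma colour_weights_mono: "colour_weights q V \<Longrightarrow> W \<subseteq> V \<Longrightarrow> colour_weights q W"
  by (auto simp: colour_weights_def)

lemma sum_lessThan_5: "(\<Sum>c<5. h c) = h 0 + h 1 + h 2 + h 3 + (h 4 :: real)" for h :: "nat \<Rightarrow> real"
  by (simp add: eval_nat_numeral)

lemma colour_expect_insert:
  assumes "finite V" "x \<notin> V"
  shows "colour_expect q (insert x V) \<phi> = (\<Sum>c<5. q x c * colour_expect q V (\<lambda>\<omega>. \<phi> (\<omega>(x := c))))"
proof -
  have "colour_expect q (insert x V) \<phi> =
      (\<Sum>(c, \<omega>)\<in>{..<5} \<times> PiE V (\<lambda>_. {..<5}). (\<Prod>v\<in>insert x V. q v ((\<omega>(x := c)) v)) * \<phi> (\<omega>(x := c)))"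
    unfolding colour_expect_def PiE_insert_eq
    by (subst sum.reindex[OF inj_combinator[OF assms(2)]]) (simp add: case_prod_unfold)
  also have "\<dots> = (\<Sum>c<5. \<Sum>\<omega>\<in>PiE V (\<lambda>_. {..<5}). (\<Prod>v\<in>insert x V. q v ((\<omega>(x := c)) v)) * \<phi> (\<omega>(x := c)))"
    by (simp add: sum.cartesian_product)
  also have "\<dots> = (\<Sum>c<5. q x c * colour_expect q V (\<lambda>\<omega>. \<phi> (\<omega>(x := c))))"
  proof -
    have "(\<Prod>v\<in>insert x V. q v ((\<omega>(x := c)) v)) = q x c * (\<Prod>v\<in>V. q v (\<omega> v))" for \<omega> c
      using assms by (auto intro!: prod.cong)
    then show ?thesis by (simp add: colour_expect_def sum_distrib_left mult.assoc)
  qed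
  finally show ?thesis .
qed

lemma colour_expect_cong:
  assumes "\<And>\<omega>. \<omega> \<in> PiE V (\<lambda>_. {..<5}) \<Longrightarrow> \<phi> \<omega> = \<psi> \<omega>"
  shows "colour_expect q V \<phi> = colour_expect q V \<psi>"
  unfolding colour_expect_def by (intro sum.cong) (auto simp: assms)

lemma colour_expect_mono:
  assumes "colour_weights q V" "\<And>\<omega>. \<omega> \<in> PiE V (\<lambda>_. {..<5}) \<Longrightarrow> \<phi> \<omega> \<le> \<psi> \<omega>"
  shows "colour_expect q V \<phi> \<le> colour_expect q V \<psi>"
  unfolding colour_expect_def
  using assms by (intro sum_mono mult_left_mono prod_nonneg) (auto simp: colour_weights_def)

text \<open>Colourings of weight zero may be ignored; this is how later proofs know which colours
  occur inside and outside the optimum.\<close>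

lemma colour_expect_mono_support:
  assumes "colour_weights q V" "\<And>\<omega>. (\<And>v. v \<in> V \<Longrightarrow> q v (\<omega> v) \<noteq> 0) \<Longrightarrow> \<phi> \<omega> \<le> \<psi> \<omega>" "finite V"
  shows "colour_expect q V \<phi> \<le> colour_expect q V \<psi>"
  unfolding colour_expect_def
proof (intro sum_mono)
  fix \<omega> show "(\<Prod>v\<in>V. q v (\<omega> v)) * \<phi> \<omega> \<le> (\<Prod>v\<in>V. q v (\<omega> v)) * \<psi> \<omega>"
  proof (cases "\<forall>v\<in>V. q v (\<omega> v) \<noteq> 0")
    case True
    then show ?thesis using assms(1,2)
      by (intro mult_left_mono prod_nonneg) (auto simp: colour_weights_def)
  next
    case False
    then have "(\<Prod>v\<in>V. q v (\<omega> v)) = 0" using assms(3) by auto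
    then show ?thesis by simp
  qed
qed

lemma colour_expect_add:
  "colour_expect q V (\<lambda>\<omega>. \<phi> \<omega> + \<psi> \<omega>) = colour_expect q V \<phi> + colour_expect q V \<psi>"
  by (simp add: colour_expect_def distrib_left sum.distrib)

lemma colour_expect_cmult:
  "colour_expect q V (\<lambda>\<omega>. a * \<phi> \<omega>) = a * colour_expect q V \<phi>"
  by (simp add: colour_expect_def sum_distrib_left mult.left_commute)

lemma colour_expect_sum:
  "colour_expect q V (\<lambda>\<omega>. \<Sum>i\<in>I. \<phi> i \<omega>) = (\<Sum>i\<in>I. colour_expect q V (\<phi> i))"
  unfolding colour_expect_def by (simp add: sum_distrib_left sum.swap[of _ _ I])

lemma colour_expect_insert':
  assumes "finite V" "x \<notin> V"
  shows "colour_expect q (insert x V) \<phi> = colour_expect q V (\<lambda>\<omega>. \<Sum>c<5. q x c * \<phi> (\<omega>(x := c)))"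
  by (simp add: colour_expect_insert[OF assms] colour_expect_sum colour_expect_cmult)

lemma prod_weights_sum:
  assumes "finite V" "colour_weights q V"
  shows "(\<Sum>\<omega>\<in>PiE V (\<lambda>_. {..<5}). \<Prod>v\<in>V. q v (\<omega> v)) = 1"
  using assms by (simp add: colour_weights_def flip: prod_sum_PiE)

lemma colour_expect_const:
  assumes "finite V" "colour_weights q V"
  shows "colour_expect q V (\<lambda>_. a) = a"
  using prod_weights_sum[OF assms] by (simp add: colour_expect_def flip: sum_distrib_right)

text \<open>Fubini for independent coordinates; it allows fixing the colours on the optimum while
  averaging over the others.\<close>

lemma colour_expect_union:
  assumes "finite A" "finite B" "A \<inter> B = {}"
  shows "colour_expect q (A \<union> B) \<phi> =
    colour_expect q A (\<lambda>\<omega>. colour_expect q B (\<lambda>\<omega>'. \<phi> (\<lambda>v. if v \<in> A then \<omega> v else \<omega>' v)))"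
  using assms
proof (induction A arbitrary: \<phi>)
  case empty
  then show ?case by (simp add: colour_expect_def)
next
  case (insert x A)
  have upd: "(\<lambda>v. if v \<in> A then \<omega> v else \<omega>' v)(x := c) =
      (\<lambda>v. if v \<in> insert x A then (\<omega>(x := c)) v else \<omega>' v)" for \<omega> \<omega>' :: "'a \<Rightarrow> nat" and c
    using insert by (auto simp: fun_eq_iff)
  have "colour_expect q (insert x A \<union> B) \<phi> =
      (\<Sum>c<5. q x c * colour_expect q (A \<union> B) (\<lambda>\<omega>. \<phi> (\<omega>(x := c))))"
    using insert by (simp add: colour_expect_insert)
  also have "\<dots> = (\<Sum>c<5. q x c * colour_expect q A (\<lambda>\<omega>. colour_expect q B
      (\<lambda>\<omega>'. \<phi> (\<lambda>v. if v \<in> insert x A then (\<omega>(x := c)) v else \<omega>' v))))"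
    using insert by (subst insert.IH) (simp_all only: upd, auto)
  also have "\<dots> = colour_expect q (insert x A) (\<lambda>\<omega>. colour_expect q B
      (\<lambda>\<omega>'. \<phi> (\<lambda>v. if v \<in> insert x A then \<omega> v else \<omega>' v)))"
    using insert by (simp add: colour_expect_insert)
  finally show ?case .
qed

section \<open>Bernoulli samples as marginals of random colourings\<close>

lemma sample_expect_insert:
  assumes "finite V" "x \<notin> V"
  shows "sample_expect (insert x V) p \<phi> =
    p * sample_expect V p (\<lambda>R. \<phi> (insert x R)) + (1 - p) * sample_expect V p \<phi>"
proof -
  have fin: "finite R" "card R \<le> card V" "x \<notin> R" if "R \<in> Pow V" for R
    using that assms finite_subset card_mono by blast+
  have "sample_expect (insert x V) p \<phi> =
      (\<Sum>R\<in>Pow V. p ^ card R * (1 - p) ^ (card (insert x V) - card R) * \<phi> R) +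
      (\<Sum>R\<in>insert x ` Pow V. p ^ card R * (1 - p) ^ (card (insert x V) - card R) * \<phi> R)"
    unfolding sample_expect_def Pow_insert using assms by (intro sum.union_disjoint) auto
  also have "(\<Sum>R\<in>insert x ` Pow V. p ^ card R * (1 - p) ^ (card (insert x V) - card R) * \<phi> R) =
      (\<Sum>R\<in>Pow V. p ^ card (insert x R) * (1 - p) ^ (card (insert x V) - card (insert x R)) * \<phi> (insert x R))"
    using assms by (intro sum.reindex_cong[of "insert x"]) (auto simp: inj_on_def)
  also have "\<dots> = p * sample_expect V p (\<lambda>R. \<phi> (insert x R))"
    unfolding sample_expect_def sum_distrib_left
    using assms fin by (intro sum.cong) auto
  also have "(\<Sum>R\<in>Pow V. p ^ card R * (1 - p) ^ (card (insert x V) - card R) * \<phi> R) = (1 - p) * sample_expect V p \<phi>"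
    unfolding sample_expect_def sum_distrib_left
    using assms fin by (intro sum.cong) (auto simp: Suc_diff_le)
  finally show ?thesis by simp
qed

lemma sample_expect_mono:
  assumes "0 \<le> p" "p \<le> 1" "\<And>R. R \<subseteq> V \<Longrightarrow> \<phi> R \<le> \<psi> R"
  shows "sample_expect V p \<phi> \<le> sample_expect V p \<psi>"
  unfolding sample_expect_def using assms by (intro sum_mono mult_left_mono) auto

text \<open>Colours 1, 2, 3 put an item into one copy of the sample only, colour 4 into all copies, colour 0
  into none.\<close>

definition colour_sample :: "'a set \<Rightarrow> nat \<Rightarrow> ('a \<Rightarrow> nat) \<Rightarrow> 'a set" where
  "colour_sample V j \<omega> = {v \<in> V. \<omega> v = j \<or> \<omega> v = 4}"

text \<open>Membership of each item in copy \<open>j\<close> is a coin of bias \<open>p\<close>, so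
  every copy taken alone has the law of the algorithm's sample, whatever the coupling between
  copies.\<close>

lemma colour_expect_sample:
  assumes "finite V" "colour_weights q V" "j < 4" "\<And>v. v \<in> V \<Longrightarrow> q v j + q v 4 = p"
  shows "colour_expect q V (\<lambda>\<omega>. \<phi> (colour_sample V j \<omega>)) = sample_expect V p \<phi>"
  using assms
proof (induction V arbitrary: \<phi>)
  case empty
  then show ?case by (simp add: colour_expect_def sample_expect_def colour_sample_def)
next
  case (insert x V)
  have IH: "colour_expect q V (\<lambda>\<omega>. \<phi> (colour_sample V j \<omega>)) = sample_expect V p \<phi>" for \<phi>
    using insert colour_weights_mono[of q "insert x V" V] by auto
  have split: "colour_sample (insert x V) j (\<omega>(x := c)) =
      (if c = j \<or> c = 4 then insert x (colour_sample V j \<omega>) else colour_sample V j \<omega>)" for \<omega> c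
    using insert by (auto simp: colour_sample_def)
  let ?a = "sample_expect V p (\<lambda>R. \<phi> (insert x R))" and ?b = "sample_expect V p \<phi>"
  have "colour_expect q (insert x V) (\<lambda>\<omega>. \<phi> (colour_sample (insert x V) j \<omega>)) =
      (\<Sum>c<5. q x c * (if c = j \<or> c = 4 then ?a else ?b))"
    unfolding colour_expect_insert[OF insert.hyps(1,2)] split
    by (intro sum.cong refl) (simp add: IH if_distrib[of \<phi>] IH[of "\<lambda>R. \<phi> (insert x R)"])
  also have "\<dots> = (\<Sum>c<5. q x c * ?b + (if c = j then q x j * (?a - ?b) else 0) + (if c = 4 then q x 4 * (?a - ?b) else 0))"
    using \<open>j < 4\<close> by (intro sum.cong) (auto simp: algebra_simps)
  also have "\<dots> = (\<Sum>c<5. q x c) * ?b + (q x j + q x 4) * (?a - ?b)"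
    using \<open>j < 4\<close> by (simp add: sum.distrib sum_distrib_right distrib_right)
  also have "\<dots> = p * ?a + (1 - p) * ?b"
    using insert.prems by (simp add: colour_weights_def algebra_simps)
  finally show ?case using sample_expect_insert[OF insert.hyps(1,2)] by simp
qed

section \<open>Expected value of a random set that covers part of the optimum\<close>

context submodular
begin

text \<open>The average is taken in two stages. With the colours on \<open>C\<close> fixed, the part
  of \<open>S\<close> outside \<open>C\<close> contains each item with probability at most
  \<open>p\<close>, which costs a factor \<open>1 - p\<close>. The part inside \<open>C\<close>
  contains \<open>T\<close> and so covers each item of \<open>C\<close> with probability at least
  \<open>t\<close>. The index \<open>u\<close> is an independent coin for the thinning.\<close>

lemma expected_value_bound:
  fixes T :: "'i \<Rightarrow> ('a \<Rightarrow> nat) \<Rightarrow> 'a set" and S :: "'i \<Rightarrow> ('a \<Rightarrow> nat) \<Rightarrow> 'a set"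
  assumes q: "colour_weights q V" and "C \<subseteq> V" "0 \<le> p" "p \<le> 1"
    and coin: "\<And>u. u \<in> U \<Longrightarrow> 0 \<le> w u" "sum w U = 1" "finite U"
    and local: "\<And>u \<omega> \<omega>'. u \<in> U \<Longrightarrow> (\<And>v. v \<in> C \<Longrightarrow> \<omega> v = \<omega>' v) \<Longrightarrow> T u \<omega> = T u \<omega>'"
    and TS: "\<And>u \<omega>. u \<in> U \<Longrightarrow> T u \<omega> \<subseteq> C \<and> T u \<omega> \<subseteq> S u \<omega> \<and> S u \<omega> \<subseteq> V"
    and outside: "\<And>u \<omega> v. u \<in> U \<Longrightarrow> v \<in> S u \<omega> - C \<Longrightarrow> \<omega> v \<noteq> 0"
    and rate: "\<And>v. v \<in> V - C \<Longrightarrow> q v 0 = 1 - p"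
    and mass: "\<And>v. v \<in> C \<Longrightarrow> t \<le> (\<Sum>u\<in>U. w u * colour_expect q C (\<lambda>\<omega>. of_bool (v \<in> T u \<omega>)))"
    and "0 \<le> t" "t \<le> 1"
  shows "(1 - p) * t * f C \<le> (\<Sum>u\<in>U. w u * colour_expect q V (\<lambda>\<omega>. f (S u \<omega>)))"
proof -
  let ?P = "\<lambda>A. PiE A (\<lambda>_. {..<5::nat})" and ?w = "\<lambda>A \<omega>. \<Prod>v\<in>A. q v (\<omega> v)"
  define D where "D = V - C"
  have fin: "finite C" "finite D" using finite_ground \<open>C \<subseteq> V\<close> finite_subset by (auto simp: D_def)
  have V: "V = C \<union> D" "C \<inter> D = {}" using \<open>C \<subseteq> V\<close> by (auto simp: D_def)
  have qC: "colour_weights q C" and qD: "colour_weights q D"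
    using q V colour_weights_mono by blast+
  have wpos: "0 \<le> ?w A \<omega>" if "A \<subseteq> V" for A \<omega>
    using q that by (intro prod_nonneg) (auto simp: colour_weights_def)
  define mrg where "mrg \<omega> \<omega>' = (\<lambda>v. if v \<in> C then \<omega> v else \<omega>' v)" for \<omega> \<omega>' :: "'a \<Rightarrow> nat"
  \<comment> \<open>Inside \<open>C\<close>, \<open>S\<close> may be any superset of
    \<open>T\<close> and may depend on all colours; taking the worst such superset leaves a
    submodular function of the outer part alone.\<close>
  define g where "g u \<omega> B = Min ((\<lambda>Q. f (Q \<union> B)) ` {Q. T u \<omega> \<subseteq> Q \<and> Q \<subseteq> C})" for u \<omega> B
  have finQ: "finite {Q. T u \<omega> \<subseteq> Q \<and> Q \<subseteq> C}" for u \<omega> using fin by auto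
  have inner: "(1 - p) * g u \<omega> {} \<le> colour_expect q D (\<lambda>\<omega>'. f (S u (mrg \<omega> \<omega>')))" if u: "u \<in> U" for u \<omega>
  proof -
    have TC: "T u \<omega> \<subseteq> C" using TS u by blast
    \<comment> \<open>For the outer part only an upper bound \<open>p\<close> on membership is
      known, hence the coefficient 0.\<close>
    have "(1 - p) * g u \<omega> {} + 0 * g u \<omega> D \<le> (\<Sum>\<omega>'\<in>?P D. ?w D \<omega>' * g u \<omega> (S u (mrg \<omega> \<omega>') - C))"
    proof (rule random_subset_bound)
      show "0 \<le> g u \<omega> X" if "X \<subseteq> D" for X
      proof -
        have "g u \<omega> X \<in> (\<lambda>Q. f (Q \<union> X)) ` {Q. T u \<omega> \<subseteq> Q \<and> Q \<subseteq> C}"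
          unfolding g_def using finQ TC by (intro Min_in) auto
        then show ?thesis using that V(1) by (auto intro!: nonneg)
      qed
      show "g u \<omega> (X \<union> Y) + g u \<omega> (X \<inter> Y) \<le> g u \<omega> X + g u \<omega> Y" if "X \<subseteq> D" "Y \<subseteq> D" for X Y
        unfolding g_def using that TC V \<open>C \<subseteq> V\<close> by (intro union_min_submodular) auto
      fix v assume v: "v \<in> D"
      have out: "\<omega>' v \<noteq> 0" if "v \<in> S u (mrg \<omega> \<omega>') - C" for \<omega>'
        using outside[OF u that] that by (simp add: mrg_def)
      have "(\<Sum>\<omega>'\<in>?P D. ?w D \<omega>' * of_bool (v \<in> S u (mrg \<omega> \<omega>') - C)) \<le> colour_expect q D (\<lambda>\<omega>'. of_bool (\<omega>' v \<noteq> 0))"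
        unfolding colour_expect_def
      proof (intro sum_mono mult_left_mono)
        show "of_bool (v \<in> S u (mrg \<omega> \<omega>') - C) \<le> (of_bool (\<omega>' v \<noteq> 0) :: real)" for \<omega>'
          using out[of \<omega>'] by (simp del: Diff_iff)
      qed (use wpos[of D] V in auto)
      also have "\<dots> = colour_expect q (D - {v}) (\<lambda>_. p)"
      proof -
        have "(\<Sum>c<5. q v c * of_bool (c \<noteq> 0)) = p"
          using bspec[OF qD[unfolded colour_weights_def] v] rate[of v] v by (simp add: sum_lessThan_5 D_def)
        then show ?thesis
          using colour_expect_insert'[of "D - {v}" v q "\<lambda>\<omega>'. of_bool (\<omega>' v \<noteq> 0)"] fin v
          by (simp add: insert_absorb)
      qed
      also have "\<dots> = p"
        using fin qD colour_weights_mono[of q D "D - {v}"] by (intro colour_expect_const) auto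
      finally show "(\<Sum>\<omega>'\<in>?P D. ?w D \<omega>' * of_bool (v \<in> S u (mrg \<omega> \<omega>') - C)) \<le> p" .
      show "0 \<le> (\<Sum>\<omega>'\<in>?P D. ?w D \<omega>' * of_bool (v \<in> S u (mrg \<omega> \<omega>') - C))"
        using wpos V by (intro sum_nonneg mult_nonneg_nonneg) auto
    next
      show "sum (?w D) (?P D) = 1" using prod_weights_sum fin qD by blast
      show "S u (mrg \<omega> \<omega>') - C \<subseteq> D" for \<omega>' using TS[OF u] V by blast
    qed (use fin wpos V \<open>0 \<le> p\<close> in auto)
    also have "\<dots> \<le> (\<Sum>\<omega>'\<in>?P D. ?w D \<omega>' * f (S u (mrg \<omega> \<omega>')))"
    proof (intro sum_mono mult_left_mono)
      fix \<omega>'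
      have "T u \<omega> = T u (mrg \<omega> \<omega>')" using local[OF u, of \<omega> "mrg \<omega> \<omega>'"] by (simp add: mrg_def)
      then have "T u \<omega> \<subseteq> S u (mrg \<omega> \<omega>') \<inter> C" using TS[OF u] by blast
      then have "g u \<omega> (S u (mrg \<omega> \<omega>') - C) \<le> f (S u (mrg \<omega> \<omega>') \<inter> C \<union> (S u (mrg \<omega> \<omega>') - C))"
        unfolding g_def using finQ by (intro Min_le) auto
      then show "g u \<omega> (S u (mrg \<omega> \<omega>') - C) \<le> f (S u (mrg \<omega> \<omega>'))"
        by (simp add: Int_Diff_Un)
    qed (use wpos V in auto)
    finally show ?thesis by (simp add: colour_expect_def)
  qed
  \<comment> \<open>With empty outer part the minimum is attained at a set between \<open>T\<close>
    and \<open>C\<close>, which inherits the covering rate of \<open>T\<close>.\<close>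
  have "\<exists>Q. T u \<omega> \<subseteq> Q \<and> Q \<subseteq> C \<and> g u \<omega> {} = f Q" if "u \<in> U" for u \<omega>
  proof -
    have "g u \<omega> {} \<in> (\<lambda>Q. f (Q \<union> {})) ` {Q. T u \<omega> \<subseteq> Q \<and> Q \<subseteq> C}"
      unfolding g_def using finQ TS[OF that, of \<omega>] by (intro Min_in) blast+
    then show ?thesis by auto
  qed
  then obtain Q where Q: "\<And>u \<omega>. u \<in> U \<Longrightarrow> T u \<omega> \<subseteq> Q u \<omega> \<and> Q u \<omega> \<subseteq> C \<and> g u \<omega> {} = f (Q u \<omega>)"
    by metis
  have sumP: "(\<Sum>i\<in>U \<times> ?P C. w (fst i) * ?w C (snd i) * F (fst i) (snd i)) =
      (\<Sum>u\<in>U. w u * colour_expect q C (F u))" for F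
    unfolding colour_expect_def
    by (simp add: sum.cartesian_product' sum_distrib_left mult.assoc)
  \<comment> \<open>With \<open>q = 1\<close> the value at the empty set drops out and the covering
    rate remains.\<close>
  have "(1 - 1) * f {} + t * f C \<le> (\<Sum>i\<in>U \<times> ?P C. w (fst i) * ?w C (snd i) * f (Q (fst i) (snd i)))"
  proof (rule random_subset_bound)
    show "sum (\<lambda>i. w (fst i) * ?w C (snd i)) (U \<times> ?P C) = 1"
      using sumP[of "\<lambda>_ _. 1"] coin(2) colour_expect_const[OF fin(1) qC] by simp
    fix v assume v: "v \<in> C"
    have le1: "colour_expect q C (\<lambda>\<omega>. of_bool (v \<in> Q u \<omega>)) \<le> 1" for u
      using colour_expect_mono[OF qC, of "\<lambda>\<omega>. of_bool (v \<in> Q u \<omega>)" "\<lambda>_. 1"]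
        colour_expect_const[OF fin(1) qC] by auto
    have "(\<Sum>u\<in>U. w u * colour_expect q C (\<lambda>\<omega>. of_bool (v \<in> Q u \<omega>))) \<le> (\<Sum>u\<in>U. w u * 1)"
      using le1 coin by (intro sum_mono mult_left_mono) auto
    then show "(\<Sum>i\<in>U \<times> ?P C. w (fst i) * ?w C (snd i) * of_bool (v \<in> Q (fst i) (snd i))) \<le> 1"
      using sumP[of "\<lambda>u \<omega>. of_bool (v \<in> Q u \<omega>)"] coin by simp
    have "(\<Sum>u\<in>U. w u * colour_expect q C (\<lambda>\<omega>. of_bool (v \<in> T u \<omega>))) \<le> (\<Sum>u\<in>U. w u * colour_expect q C (\<lambda>\<omega>. of_bool (v \<in> Q u \<omega>)))"
      using Q coin by (intro sum_mono mult_left_mono colour_expect_mono[OF qC]) (auto simp: of_bool_def)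
    then show "t \<le> (\<Sum>i\<in>U \<times> ?P C. w (fst i) * ?w C (snd i) * of_bool (v \<in> Q (fst i) (snd i)))"
      using sumP[of "\<lambda>u \<omega>. of_bool (v \<in> Q u \<omega>)"] mass[OF v] by simp
  next
    show "Q (fst i) (snd i) \<subseteq> C" if "i \<in> U \<times> ?P C" for i
      using Q[of "fst i" "snd i"] that by auto
  qed (use fin \<open>C \<subseteq> V\<close> wpos coin Q nonneg lattice_submodular \<open>0 \<le> t\<close> \<open>t \<le> 1\<close> in auto)
  then have "t * f C \<le> (\<Sum>u\<in>U. w u * colour_expect q C (\<lambda>\<omega>. f (Q u \<omega>)))"
    using sumP[of "\<lambda>u \<omega>. f (Q u \<omega>)"] by simp
  then have "(1 - p) * (t * f C) \<le> (1 - p) * (\<Sum>u\<in>U. w u * colour_expect q C (\<lambda>\<omega>. f (Q u \<omega>)))"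
    using \<open>p \<le> 1\<close> by (intro mult_left_mono) auto
  also have "\<dots> = (\<Sum>u\<in>U. w u * colour_expect q C (\<lambda>\<omega>. (1 - p) * f (Q u \<omega>)))"
    by (simp add: colour_expect_cmult sum_distrib_left mult.left_commute)
  also have "\<dots> \<le> (\<Sum>u\<in>U. w u * colour_expect q C (\<lambda>\<omega>. colour_expect q D (\<lambda>\<omega>'. f (S u (mrg \<omega> \<omega>')))))"
  proof (intro sum_mono mult_left_mono colour_expect_mono[OF qC])
    show "(1 - p) * f (Q u \<omega>) \<le> colour_expect q D (\<lambda>\<omega>'. f (S u (mrg \<omega> \<omega>')))" if "u \<in> U" for u \<omega>
      using inner[OF that] Q[OF that] by metis
  qed (use coin in auto)
  also have "\<dots> = (\<Sum>u\<in>U. w u * colour_expect q V (\<lambda>\<omega>. f (S u \<omega>)))"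
    using colour_expect_union[OF fin V(2), of q] V(1) by (simp add: mrg_def)
  finally show ?thesis by (simp add: mult.assoc)
qed

end

section \<open>Certificates of the greedy phase\<close>

locale greedy_instance = submodular V f for V :: "'a set" and f +
  fixes m :: nat and G :: "nat \<Rightarrow> 'a set" and \<alpha> :: nat
  assumes partition: "is_partition V m G" and kmin_gt_1: "kmin m G > 1" and groups: "m \<ge> 1"
begin

abbreviation cap :: "nat \<Rightarrow> nat" where "cap \<equiv> rcap m G \<alpha>"

lemma group_subset: "i < m \<Longrightarrow> G i \<subseteq> V"
  and group_disjoint: "i < m \<Longrightarrow> j < m \<Longrightarrow> x \<in> G i \<Longrightarrow> x \<in> G j \<Longrightarrow> i = j"
  and group_exists: "x \<in> V \<Longrightarrow> \<exists>i<m. x \<in> G i"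
  using partition unfolding is_partition_def by blast+

lemma kmin_le: "i < m \<Longrightarrow> kmin m G \<le> card (G i)"
  unfolding kmin_def by (intro Min_le) auto

lemma cap_pos: "i < m \<Longrightarrow> 0 < cap i"
  using kmin_le[of i] kmin_gt_1 by (auto simp: rcap_def div_greater_zero_iff)

lemma sum_over_groups:
  assumes "A \<subseteq> V"
  shows "sum g A = (\<Sum>i<m. sum g (A \<inter> G i))"
proof -
  have "A = (\<Union>i<m. A \<inter> G i)" using assms group_exists by auto
  moreover have "sum g (\<Union>i<m. A \<inter> G i) = (\<Sum>i<m. sum g (A \<inter> G i))"
    using finite_subset[OF assms finite_ground] group_disjoint by (intro sum.UNION_disjoint) blast+
  ultimately show ?thesis by simp
qed

text \<open>\<open>\<gamma> z\<close> is the marginal of \<open>z\<close> at the moment of its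
  selection. The last clause is the form in which a greedy set is later added to an arbitrary set
  \<open>Y\<close>: each item pays the smaller of its own gain and its marginal at
  \<open>Y\<close>.\<close>

definition greedy_gains :: "'a set \<Rightarrow> 'a set \<Rightarrow> ('a \<Rightarrow> real) \<Rightarrow> bool" where
  "greedy_gains R A \<gamma> \<longleftrightarrow> A \<subseteq> R \<and> semi_feasible m G \<alpha> A \<and> (\<forall>z\<in>A. 0 < \<gamma> z) \<and>
    sum \<gamma> A = f A - f {} \<and> (\<forall>i<m. \<forall>z\<in>A \<inter> G i. \<forall>x\<in>R \<inter> G i. marg x A \<le> \<gamma> z) \<and>
    (\<forall>Y\<subseteq>V. f (Y \<union> A) \<le> f Y + (\<Sum>z\<in>A. min (\<gamma> z) (marg z Y)))"

text \<open>Capacities see only the group counts, so an item may be replaced by another of its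
  group. Hence every unselected sampled item of a group competes whenever an item of that group is
  selected.\<close>

lemma semi_feasible_exchange:
  assumes "semi_feasible m G \<alpha> (insert e A)" "e \<in> G i" "x \<in> G i" "i < m" "e \<notin> A" "finite A"
  shows "semi_feasible m G \<alpha> (insert x A)"
  unfolding semi_feasible_def
proof (intro allI impI)
  fix j assume j: "j < m"
  show "card (insert x A \<inter> G j) \<le> cap j"
  proof (cases "j = i")
    case True
    have "card (insert x A \<inter> G i) \<le> Suc (card (A \<inter> G i))"
      using assms(3,6) by (simp add: card_insert_if)
    also have "\<dots> = card (insert e A \<inter> G i)" using assms(2,5,6) by simp
    finally show ?thesis using assms(1) j True by (auto simp: semi_feasible_def)
  next
    case False
    then have "insert x A \<inter> G j \<subseteq> insert e A \<inter> G j"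
      using group_disjoint[OF assms(4) j assms(3)] by auto
    then have "card (insert x A \<inter> G j) \<le> card (insert e A \<inter> G j)"
      using assms(6) by (intro card_mono) auto
    then show ?thesis using assms(1) j by (auto simp: semi_feasible_def)
  qed
qed

lemma greedy_reach_gains:
  assumes "greedy_reach m G \<alpha> f R A" "R \<subseteq> V"
  shows "\<exists>\<gamma>. greedy_gains R A \<gamma>"
  using assms(1)
proof induction
  case start
  then show ?case by (auto simp: greedy_gains_def semi_feasible_def)
next
  case (step A e)
  then obtain \<gamma> where \<gamma>: "greedy_gains R A \<gamma>" by blast
  have AR: "A \<subseteq> R" "A \<subseteq> V" "e \<notin> A" "e \<in> V" "e \<in> R"
    using \<gamma> assms(2) step.hyps by (auto simp: greedy_gains_def)
  have fin: "finite A" using AR(2) finite_ground by (rule finite_subset)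
  define \<gamma>' where "\<gamma>' = \<gamma>(e := marg e A)"
  have \<gamma>'e: "\<gamma>' e = marg e A" by (simp add: \<gamma>'_def)
  have pos: "0 < marg e A" using step.hyps by (simp add: marg_def)
  have sums: "sum h (insert e A) = h e + sum h A" for h :: "'a \<Rightarrow> real" using AR fin by simp
  have sum_eq: "sum \<gamma>' A = sum \<gamma> A" "(\<Sum>z\<in>A. min (\<gamma>' z) (F z)) = (\<Sum>z\<in>A. min (\<gamma> z) (F z))" for F
    using AR by (auto simp: \<gamma>'_def intro!: sum.cong)
  have "greedy_gains R (insert e A) \<gamma>'"
    unfolding greedy_gains_def
  proof (intro conjI allI impI ballI)
    show "insert e A \<subseteq> R" using AR by auto
    show "semi_feasible m G \<alpha> (insert e A)" using step.hyps by simp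
    show "0 < \<gamma>' z" if "z \<in> insert e A" for z
      using that \<gamma> pos AR by (auto simp: \<gamma>'_def greedy_gains_def)
    show "sum \<gamma>' (insert e A) = f (insert e A) - f {}"
      using \<gamma> unfolding sums sum_eq \<gamma>'e by (simp add: marg_def greedy_gains_def)
  next
    fix i z x assume i: "i < m" and z: "z \<in> insert e A \<inter> G i" and x: "x \<in> R \<inter> G i"
    show "marg x (insert e A) \<le> \<gamma>' z"
    proof (cases "x \<in> insert e A")
      case True
      then show ?thesis using z \<gamma> pos by (auto simp: \<gamma>'_def greedy_gains_def less_imp_le)
    next
      case False
      then have "marg x (insert e A) \<le> marg x A"
        using AR x assms(2) by (intro marg_antimono) auto
      also have "\<dots> \<le> \<gamma>' z"
      proof (cases "z = e")
        case True
        \<comment> \<open>\<open>x\<close> was a feasible candidate when \<open>e\<close> was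
          chosen, so its marginal did not exceed that of \<open>e\<close>.\<close>
        then have "semi_feasible m G \<alpha> (insert x A)"
          using semi_feasible_exchange[of e A i x] step.hyps i x z AR fin by simp
        then show ?thesis using step.hyps x False True by (auto simp: \<gamma>'_def marg_def)
      next
        case False
        then show ?thesis using \<gamma> i z x by (auto simp: \<gamma>'_def greedy_gains_def)
      qed
      finally show ?thesis .
    qed
  next
    fix Y assume Y: "Y \<subseteq> V"
    \<comment> \<open>Both bounds hold because \<open>Y \<union> A\<close> contains \<open>A\<close>
      as well as \<open>Y\<close>; if \<open>e\<close> is already in \<open>Y\<close>, both sides
      are 0.\<close>
    have "f (Y \<union> insert e A) - f (Y \<union> A) \<le> min (marg e A) (marg e Y)"
    proof (cases "e \<in> Y")
      case True
      then show ?thesis using pos by (simp add: insert_absorb)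
    next
      case False
      then have "marg e (Y \<union> A) \<le> marg e A" "marg e (Y \<union> A) \<le> marg e Y"
        using Y AR by (auto intro!: marg_antimono)
      then show ?thesis by (simp add: marg_def)
    qed
    moreover have "f (Y \<union> A) \<le> f Y + (\<Sum>z\<in>A. min (\<gamma> z) (marg z Y))"
      using \<gamma> Y by (auto simp: greedy_gains_def)
    ultimately show "f (Y \<union> insert e A) \<le> f Y + (\<Sum>z\<in>insert e A. min (\<gamma>' z) (marg z Y))"
      unfolding sums sum_eq \<gamma>'e by linarith
  qed
  then show ?case by auto
qed

text \<open>The two completions meet exactly in the greedy set, because the added sets are disjoint
  within a group and across groups. Submodularity, with a nonnegative value at the union, gives
  \<open>f A \<le> f A1 + f A2\<close>.\<close>

lemma completion_loses_half:
  assumes "SG_output m G \<alpha> f R B" "R \<subseteq> V"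
  shows "\<exists>A. greedy_result m G \<alpha> f R A \<and> f A \<le> 2 * f B"
proof -
  from assms(1) obtain A X Y where
    A: "greedy_result m G \<alpha> f R A" and
    XY: "\<forall>i\<in>{i. i < m \<and> card (A \<inter> G i) < cap i}. X i \<subseteq> G i - A \<and> Y i \<subseteq> G i - A \<and> X i \<inter> Y i = {}" and
    B: "f B = max (f (A \<union> (\<Union>i\<in>{i. i < m \<and> card (A \<inter> G i) < cap i}. X i)))
                  (f (A \<union> (\<Union>i\<in>{i. i < m \<and> card (A \<inter> G i) < cap i}. Y i)))"
    unfolding SG_output_def Let_def by blast
  define L where "L = {i. i < m \<and> card (A \<inter> G i) < cap i}"
  define A1 where "A1 = A \<union> (\<Union>i\<in>L. X i)"
  define A2 where "A2 = A \<union> (\<Union>i\<in>L. Y i)"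
  have "A \<subseteq> V"
    using greedy_reach_gains[of R A] A assms(2) by (auto simp: greedy_result_def greedy_gains_def)
  then have sub: "A1 \<subseteq> V" "A2 \<subseteq> V"
    using XY group_subset unfolding A1_def A2_def L_def by blast+
  have meet: "x \<in> A" if "x \<in> A1" "x \<in> A2" for x
  proof (rule ccontr)
    assume "x \<notin> A"
    with that obtain i j where ij: "i \<in> L" "x \<in> X i" "j \<in> L" "x \<in> Y j"
      unfolding A1_def A2_def by blast
    then have "x \<in> G i" "x \<in> G j" using XY by (auto simp: L_def)
    then have "i = j" using ij group_disjoint by (auto simp: L_def)
    then show False using ij XY by (auto simp: L_def)
  qed
  have "A1 \<inter> A2 = A" using meet by (auto simp: A1_def A2_def)
  then have "f A \<le> f A1 + f A2"
    using lattice_submodular[OF sub] nonneg[of "A1 \<union> A2"] sub by auto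
  also have "\<dots> \<le> 2 * f B" using B by (simp add: A1_def A2_def L_def)
  finally show ?thesis using A by blast
qed

text \<open>\<open>h i\<close> is a price for the sampled items of group \<open>i\<close>, and the
  gains in the group can pay it once per unit of capacity. The charging arguments below rely on
  these inequalities instead of the run of the greedy phase.\<close>

definition certificate :: "'a set \<Rightarrow> 'a set \<Rightarrow> ('a \<Rightarrow> real) \<Rightarrow> (nat \<Rightarrow> real) \<Rightarrow> bool" where
  "certificate R A \<gamma> h \<longleftrightarrow> greedy_gains R A \<gamma> \<and>
    (\<forall>i<m. 0 \<le> h i \<and> (0 < h i \<longrightarrow> card (A \<inter> G i) = cap i) \<and>
      real (cap i) * h i \<le> sum \<gamma> (A \<inter> G i) \<and> (\<forall>x\<in>R \<inter> G i. marg x A \<le> h i))"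

lemma greedy_result_certificate:
  assumes "greedy_result m G \<alpha> f R A" "R \<subseteq> V"
  shows "\<exists>\<gamma> h. certificate R A \<gamma> h"
proof -
  obtain \<gamma> where \<gamma>: "greedy_gains R A \<gamma>"
    using assms greedy_reach_gains unfolding greedy_result_def by blast
  then have A: "A \<subseteq> V" and pos: "\<And>z. z \<in> A \<Longrightarrow> 0 < \<gamma> z"
    using assms(2) by (auto simp: greedy_gains_def)
  have fin: "finite A" using A finite_ground by (rule finite_subset)
  \<comment> \<open>In a saturated group the smallest gain works. In an unsaturated one the price 0
    works: every sampled item could still be added, yet the greedy phase stopped.\<close>
  define h where "h i = (if card (A \<inter> G i) < cap i then 0 else Min (\<gamma> ` (A \<inter> G i)))" for i
  have "0 \<le> h i \<and> (0 < h i \<longrightarrow> card (A \<inter> G i) = cap i) \<and>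
      real (cap i) * h i \<le> sum \<gamma> (A \<inter> G i) \<and> (\<forall>x\<in>R \<inter> G i. marg x A \<le> h i)" if i: "i < m" for i
  proof (cases "card (A \<inter> G i) < cap i")
    case True
    have "marg x A \<le> 0" if x: "x \<in> R \<inter> G i" for x
    proof (cases "x \<in> A")
      case False
      have "semi_feasible m G \<alpha> (insert x A)"
        unfolding semi_feasible_def
      proof (intro allI impI)
        fix j assume "j < m"
        then show "card (insert x A \<inter> G j) \<le> cap j"
          using True x fin \<gamma> group_disjoint[OF i \<open>j < m\<close>, of x]
          by (cases "j = i"; cases "x \<in> G j")
            (auto simp: card_insert_if greedy_gains_def semi_feasible_def)
      qed
      then show ?thesis using assms(1) x False by (auto simp: greedy_result_def marg_def)
    qed simp
    moreover have "0 \<le> sum \<gamma> (A \<inter> G i)" using pos by (intro sum_nonneg) (auto simp: less_imp_le)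
    ultimately show ?thesis using True by (auto simp: h_def)
  next
    case False
    then have card: "card (A \<inter> G i) = cap i" using \<gamma> i by (auto simp: greedy_gains_def semi_feasible_def le_less)
    then have ne: "A \<inter> G i \<noteq> {}" using cap_pos[OF i] by auto
    have h: "h i = Min (\<gamma> ` (A \<inter> G i))" using False by (simp add: h_def)
    have "h i \<in> \<gamma> ` (A \<inter> G i)" unfolding h using fin ne by (intro Min_in) auto
    then obtain z where z: "z \<in> A \<inter> G i" "h i = \<gamma> z" by blast
    have "real (card (A \<inter> G i)) * h i \<le> sum \<gamma> (A \<inter> G i)"
      unfolding h using fin by (intro sum_bounded_below) auto
    then show ?thesis using z card pos \<gamma> i by (auto simp: greedy_gains_def less_imp_le)
  qed
  then show ?thesis using \<gamma> by (auto simp: certificate_def)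
qed

text \<open>Marginals only drop from \<open>A\<close> to the larger \<open>W\<close>, and items of
  \<open>A\<close> add nothing, so every other item of \<open>T\<close> costs at most the price of
  its group. \<open>W\<close> may exceed \<open>A\<close> so that several greedy sets can be joined
  first.\<close>

lemma union_le_charges:
  assumes "certificate R A \<gamma> h" "R \<subseteq> V" "A \<subseteq> W" "W \<subseteq> V" "T \<subseteq> R"
  shows "f (W \<union> T) \<le> f W + (\<Sum>i<m. real (card (T \<inter> G i - A)) * h i)"
proof -
  have TV: "T \<subseteq> V" using assms by auto
  have "f (W \<union> T) \<le> f W + (\<Sum>e\<in>T. marg e W)"
    using assms by (intro union_le_sum_marg) auto
  also have "(\<Sum>e\<in>T. marg e W) = (\<Sum>i<m. \<Sum>e\<in>T \<inter> G i. marg e W)"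
    using TV by (rule sum_over_groups)
  also have "\<dots> \<le> (\<Sum>i<m. real (card (T \<inter> G i - A)) * h i)"
  proof (intro sum_mono)
    fix i assume i: "i \<in> {..<m}"
    have "(\<Sum>e\<in>T \<inter> G i. marg e W) = (\<Sum>e\<in>T \<inter> G i - A. marg e W)"
      using assms(3) finite_subset[OF TV finite_ground]
      by (intro sum.mono_neutral_right) auto
    also have "\<dots> \<le> (\<Sum>e\<in>T \<inter> G i - A. h i)"
    proof (intro sum_mono)
      fix e assume e: "e \<in> T \<inter> G i - A"
      then have le: "marg e A \<le> h i" "0 \<le> h i" using assms(1,5) i by (auto simp: certificate_def)
      show "marg e W \<le> h i"
      proof (cases "e \<in> W")
        case False
        then have "marg e W \<le> marg e A" using assms TV e by (intro marg_antimono) auto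
        then show ?thesis using le by simp
      qed (use le in simp)
    qed
    finally show "(\<Sum>e\<in>T \<inter> G i. marg e W) \<le> real (card (T \<inter> G i - A)) * h i" by simp
  qed
  finally show ?thesis by simp
qed

lemma certificate_gain:
  assumes "certificate R A \<gamma> h" "R \<subseteq> V"
  shows "(\<Sum>i<m. sum \<gamma> (A \<inter> G i)) = f A - f {}"
  using assms sum_over_groups[of A \<gamma>] by (auto simp: certificate_def greedy_gains_def)

end

section \<open>Charges of three disjoint samples\<close>

text \<open>The minimum of the gains of several copies is charged to the copies with the smallest counts
  \<open>n\<close>, \<open>a\<close>, \<open>b\<close> of sampled items of the optimum, in equal parts.\<close>

definition pair_share :: "nat \<Rightarrow> nat \<Rightarrow> real" where
  "pair_share n a = (if n < a then 1 else if n = a then 1/2 else 0)"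

definition triple_share :: "nat \<Rightarrow> nat \<Rightarrow> nat \<Rightarrow> real" where
  "triple_share n a b = (if a < n \<or> b < n then 0 else if n < a \<and> n < b then 1
     else if n = a \<and> n = b then 1/3 else 1/2)"

definition share :: "nat \<Rightarrow> nat \<Rightarrow> nat \<Rightarrow> real" where
  "share n a b = pair_share n a + pair_share n b + 3 * triple_share n a b"

lemma min_le_weighted:
  fixes x y :: real
  assumes "s + t = 1" "0 \<le> s" "0 \<le> t"
  shows "min x y \<le> s * x + t * y"
proof -
  have "min x y = s * min x y + t * min x y" using assms(1) by (simp flip: distrib_right)
  also have "\<dots> \<le> s * x + t * y" using assms by (intro add_mono mult_left_mono) auto
  finally show ?thesis .
qed

lemma min3_le_weighted:
  fixes x y z :: real
  assumes "s + t + u = 1" "0 \<le> s" "0 \<le> t" "0 \<le> u"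
  shows "min x (min y z) \<le> s * x + t * y + u * z"
proof -
  let ?m = "min x (min y z)"
  have "?m = s * ?m + t * ?m + u * ?m" using assms(1) by (simp flip: distrib_right)
  also have "\<dots> \<le> s * x + t * y + u * z" using assms by (intro add_mono mult_left_mono) auto
  finally show ?thesis .
qed

text \<open>The left side is what arises from the three cyclic orders of the copies: each pair
  minimum once, the triple minimum three times. For each minimum the shares of the copies add up to
  1, and a minimum is at most any convex combination.\<close>

lemma mins_le_shares:
  fixes x y z :: real
  shows "min x y + min y z + min z x + 3 * min x (min y z) \<le> x * share a b c + y * share b c a + z * share c a b"
proof -
  have p: "min x' y' \<le> pair_share n n' * x' + pair_share n' n * y'" for x' y' :: real and n n'
    by (rule min_le_weighted) (auto simp: pair_share_def)
  have "min x (min y z) \<le> triple_share a b c * x + triple_share b c a * y + triple_share c a b * z"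
    by (rule min3_le_weighted) (auto simp: triple_share_def)
  then show ?thesis
    using p[of x y a b] p[of y z b c] p[of z x c a] by (simp add: share_def algebra_simps)
qed

text \<open>Three times the cost, per unit of gain, of the first copy and of the charges for \<open>n\<close> sampled items of the
  optimum, when \<open>T\<close> keeps all of them for \<open>n = 1\<close>, with probability \<open>7/10\<close> for \<open>n = 2\<close>, and none for
  \<open>n = 3\<close>; see \<open>average_load\<close>.\<close>

definition load :: "nat \<Rightarrow> real" where
  "load n = (if n = 0 then 1 else if n = 1 then 4 else if n = 2 then 26/5 else 3)"

section \<open>Averages over the colours of three items of the optimum\<close>

definition wsum :: "real \<Rightarrow> nat \<Rightarrow> nat \<Rightarrow> nat \<Rightarrow> (nat \<Rightarrow> real) \<Rightarrow> real" where
  "wsum p j k l X = p * X j + p * X k + p * X l + (1 - 3 * p) * X 0"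

text \<open>\<open>p\<close> is the positive root of \<open>4 * x^2 + 2 * x = 1\<close>, half the
  inverse golden ratio. Powers of \<open>p\<close> thus become linear in \<open>p\<close>, and
  polynomial inequalities reduce to linear ones on a small interval.\<close>

lemma golden_power:
  fixes p :: real
  defines "p \<equiv> (sqrt 5 - 1) / 4"
  shows "p ^ 2 = 1/4 - p/2" "p ^ 3 = p/2 - 1/8" "309/1000 < p" "p < 3091/10000"
proof -
  show sq: "p ^ 2 = 1/4 - p/2" by (simp add: p_def power2_eq_square field_simps)
  have "p ^ 3 = p * p ^ 2" by (simp add: power3_eq_cube power2_eq_square)
  also have "\<dots> = p * (1/4 - p/2)" by (simp only: sq)
  also have "\<dots> = p/4 - p^2/2" by (simp add: power2_eq_square field_simps)
  finally show "p ^ 3 = p/2 - 1/8" using sq by linarith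
  have "2236/1000 < sqrt 5" by (rule real_less_rsqrt) (simp add: power2_eq_square)
  moreover have "sqrt 5 < 22364/10000" by (rule real_less_lsqrt) (simp_all add: power2_eq_square)
  ultimately show "309/1000 < p" "p < 3091/10000" by (auto simp: p_def)
qed

text \<open>\<open>\<Phi>\<close> stands for the gain of copy \<open>j\<close>, which sees only
  which of the three items have colour \<open>j\<close>. The comparison is made separately for each
  such pattern: in all of them 27/5 bounds the conditional mean of load plus share.\<close>

lemma three_colour_block:
  fixes p :: real and \<Phi> :: "bool \<Rightarrow> bool \<Rightarrow> bool \<Rightarrow> real"
  defines "p \<equiv> (sqrt 5 - 1) / 4"
  assumes dist: "j \<noteq> k" "k \<noteq> l" "j \<noteq> l" "j \<noteq> 0" "k \<noteq> 0" "l \<noteq> 0"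
    and nonneg: "\<And>a b c. 0 \<le> \<Phi> a b c"
  defines "N \<equiv> \<lambda>i c d e :: nat. of_bool (c = i) + of_bool (d = i) + of_bool (e = i) :: nat"
  shows "wsum p j k l (\<lambda>c. wsum p j k l (\<lambda>d. wsum p j k l (\<lambda>e. \<Phi> (c = j) (d = j) (e = j) *
      (load (N j c d e) + share (N j c d e) (N k c d e) (N l c d e)))))
    \<le> 27/5 * wsum p j k l (\<lambda>c. wsum p j k l (\<lambda>d. wsum p j k l (\<lambda>e. \<Phi> (c = j) (d = j) (e = j))))"
    (is "?L \<le> 27/5 * ?R")
proof -
  \<comment> \<open>\<open>S0\<close> and \<open>S1\<close> below are the slacks when no item, or
    one item, has colour \<open>j\<close>: the factors 22/5 and 7/5 are \<open>27/5 - load 0\<close>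
    and \<open>27/5 - load 1\<close>, and the subtracted polynomial is the weighted share over the
    colours of the remaining items.\<close>
  define w where "w = 1 - 3 * p"
  define S0 where "S0 = (p + p + w) ^ 3 * (22/5) - (36 * p^3 + 48 * p^2 * w + 18 * p * w^2 + 2 * w^3)"
  define S1 where "S1 = (p + p + w) ^ 2 * (7/5) - (6 * p^2 + 2 * p * w)"
  note simps = load_def share_def pair_share_def triple_share_def
  have eq: "27/5 * ?R - ?L =
      \<Phi> True True True * (p ^ 3 * (12/5)) +
      (\<Phi> True True False + \<Phi> True False True + \<Phi> False True True) * (p ^ 2 * (p + p + w) * (1/5)) +
      (\<Phi> True False False + \<Phi> False True False + \<Phi> False False True) * (p * S1) +
      \<Phi> False False False * S0"
    unfolding wsum_def w_def[symmetric] N_def S0_def S1_def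
    using dist dist[symmetric]
    by (simp add: simps) (simp add: field_simps power2_eq_square power3_eq_cube)
  have p: "p ^ 2 = 1/4 - p/2" "p ^ 3 = p/2 - 1/8" "309/1000 < p" "p < 3091/10000"
    using golden_power unfolding p_def by auto
  have "0 \<le> w" using p(4) by (simp add: w_def)
  moreover have "0 \<le> S1"
  proof -
    have "S1 = 7/5 - 24/5 * p + 7/5 * p^2" 
      by (simp add: S1_def w_def field_simps power2_eq_square)
    then show ?thesis using p by linarith
  qed
  moreover have "0 \<le> S0"
  proof -
    have "S0 = 12/5 - 66/5 * p + 96/5 * p^2 - 22/5 * p^3"
      by (simp add: S0_def w_def field_simps power2_eq_square power3_eq_cube)
    then show ?thesis using p by linarith
  qed
  ultimately have "0 \<le> 27/5 * ?R - ?L"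
    unfolding eq using nonneg p(3) by (intro add_nonneg_nonneg mult_nonneg_nonneg) auto
  then show ?thesis by simp
qed


text \<open>Each item still lies in any one copy with probability \<open>p\<close>, but inside
  \<open>C\<close> the copies are disjoint, which needs \<open>3 * p \<le> 1\<close>, and outside
  \<open>C\<close> they coincide.\<close>

definition copy_weights :: "'a set \<Rightarrow> real \<Rightarrow> 'a \<Rightarrow> nat \<Rightarrow> real" where
  "copy_weights C p v c = (if v \<in> C then (if c \<in> {1, 2, 3} then p else if c = 0 then 1 - 3 * p else 0)
     else (if c = 4 then p else if c = 0 then 1 - p else 0))"

lemma copy_weights_valid:
  assumes "0 \<le> p" "3 * p \<le> 1"
  shows "colour_weights (copy_weights C p) V"
    and "j \<in> {1, 2, 3} \<Longrightarrow> copy_weights C p v j + copy_weights C p v 4 = p"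
  using assms by (auto simp: colour_weights_def copy_weights_def sum_lessThan_5)

lemma copy_weights_sum:
  assumes "{j, k, l} = {1, 2, 3 :: nat}" "v \<in> C"
  shows "(\<Sum>c<5. copy_weights C p v c * X c) = wsum p j k l X"
proof -
  have "(\<Sum>c<5. copy_weights C p v c * X c) = p * (\<Sum>c\<in>{1,2,3}. X c) + (1 - 3 * p) * X 0"
    using assms(2) by (simp add: copy_weights_def sum_lessThan_5 algebra_simps)
  also have "(\<Sum>c\<in>{1,2,3}. X c) = X j + X k + X l"
  proof -
    have "card {j, k, l} = 3" using assms(1) by simp
    then have "j \<noteq> k" "k \<noteq> l" "j \<noteq> l" by (auto simp: card_insert_if split: if_splits)
    then have "(\<Sum>c\<in>{j, k, l}. X c) = X j + X k + X l" by simp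
    then show ?thesis using assms(1) by simp
  qed
  finally show ?thesis by (simp add: wsum_def algebra_simps)
qed

lemma colour_expect_block:
  assumes "finite V" "B \<subseteq> V" "B \<subseteq> C" "card B = 3" "{j, k, l} = {1, 2, 3 :: nat}"
  obtains x y z where "B = {x, y, z}" "x \<noteq> y" "x \<noteq> z" "y \<noteq> z"
    "\<And>\<phi>. colour_expect (copy_weights C p) V \<phi> =
      colour_expect (copy_weights C p) (V - {x, y, z}) (\<lambda>\<omega>. wsum p j k l (\<lambda>c. wsum p j k l (\<lambda>d. wsum p j k l (\<lambda>e.
        \<phi> (\<omega>(z := c, y := d, x := e))))))"
proof -
  from \<open>card B = 3\<close> obtain x y z where B: "B = {x, y, z}" "x \<noteq> y" "x \<noteq> z" "y \<noteq> z"
    unfolding card_3_iff by blast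
  define W where "W = V - {x, y, z}"
  have V: "V = insert x (insert y (insert z W))" using assms(2) B by (auto simp: W_def)
  have W: "finite W" "x \<notin> W" "y \<notin> W" "z \<notin> W" using assms(1) by (auto simp: W_def)
  have "colour_expect (copy_weights C p) V \<phi> =
      colour_expect (copy_weights C p) W (\<lambda>\<omega>. wsum p j k l (\<lambda>c. wsum p j k l (\<lambda>d. wsum p j k l (\<lambda>e.
        \<phi> (\<omega>(z := c, y := d, x := e))))))" for \<phi>
    unfolding V using W B assms(3) copy_weights_sum[OF assms(5), of _ C p]
    by (simp add: colour_expect_insert')
  then show ?thesis using that B by (auto simp: W_def)
qed

abbreviation colour_count :: "'a set \<Rightarrow> nat \<Rightarrow> ('a \<Rightarrow> nat) \<Rightarrow> nat" where
  "colour_count B j \<omega> \<equiv> card {v \<in> B. \<omega> v = j}"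

lemma colour_count_block:
  assumes "x \<noteq> y" "x \<noteq> z" "y \<noteq> z"
  shows "colour_count {x, y, z} i (\<omega>(z := c, y := d, x := e)) = of_bool (c = i) + of_bool (d = i) + of_bool (e = i)"
proof -
  have "{v \<in> {x, y, z}. (\<omega>(z := c, y := d, x := e)) v = i} =
      (if c = i then {z} else {}) \<union> (if d = i then {y} else {}) \<union> (if e = i then {x} else {})"
    using assms by auto
  then show ?thesis using assms by auto
qed

text \<open>With all colours outside the block frozen, \<open>H\<close> of copy \<open>j\<close> is
  a function of which block items have colour \<open>j\<close>, so the three-item estimate applies.
  The indices are a permutation of 1, 2, 3, so one statement serves all copies.\<close>

lemma expected_load_bound:
  fixes H :: "'a set \<Rightarrow> real"
  defines "p \<equiv> (sqrt 5 - 1) / 4"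
  assumes "finite V" "B \<subseteq> V" "B \<subseteq> C" "card B = 3" and jkl: "{j, k, l} = {1, 2, 3 :: nat}"
    and H: "\<And>R. R \<subseteq> V \<Longrightarrow> 0 \<le> H R"
  shows "colour_expect (copy_weights C p) V (\<lambda>\<omega>. H (colour_sample V j \<omega>) *
      (load (colour_count B j \<omega>) + share (colour_count B j \<omega>) (colour_count B k \<omega>) (colour_count B l \<omega>)))
    \<le> 27/5 * colour_expect (copy_weights C p) V (\<lambda>\<omega>. H (colour_sample V j \<omega>))"
proof -
  obtain x y z where B: "B = {x, y, z}" and xyz: "x \<noteq> y" "x \<noteq> z" "y \<noteq> z" and
    E: "\<And>\<phi>. colour_expect (copy_weights C p) V \<phi> =
      colour_expect (copy_weights C p) (V - {x, y, z}) (\<lambda>\<omega>. wsum p j k l (\<lambda>c. wsum p j k l (\<lambda>d. wsum p j k l (\<lambda>e.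
        \<phi> (\<omega>(z := c, y := d, x := e))))))"
    using colour_expect_block[OF assms(2-6), of p] by blast
  have dist: "j \<noteq> k" "k \<noteq> l" "j \<noteq> l" "j \<noteq> 0" "k \<noteq> 0" "l \<noteq> 0" "j \<noteq> 4" "k \<noteq> 4" "l \<noteq> 4"
  proof -
    have "card {j, k, l} = 3" using jkl by simp
    then show "j \<noteq> k" "k \<noteq> l" "j \<noteq> l" by (auto simp: card_insert_if split: if_splits)
    have "{j, k, l} \<subseteq> {1, 2, 3}" using jkl by simp
    then show "j \<noteq> 0" "k \<noteq> 0" "l \<noteq> 0" "j \<noteq> 4" "k \<noteq> 4" "l \<noteq> 4" by auto
  qed
  define \<Phi> where "\<Phi> \<omega> b1 b2 b3 = H (colour_sample (V - {x, y, z}) j \<omega> \<union>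
    (if b1 then {z} else {}) \<union> (if b2 then {y} else {}) \<union> (if b3 then {x} else {}))" for \<omega> b1 b2 b3
  have sub: "{x, y, z} \<subseteq> V" using assms B by auto
  \<comment> \<open>Colour 4 has weight 0 inside \<open>C\<close>; away from it a block item enters
    the sample only through colour \<open>j\<close>.\<close>
  have sample: "H (colour_sample V j (\<omega>(z := c, y := d, x := e))) = \<Phi> \<omega> (c = j) (d = j) (e = j)"
    if "c \<noteq> 4" "d \<noteq> 4" "e \<noteq> 4" for \<omega> c d e
    unfolding \<Phi>_def using that xyz sub by (intro arg_cong[of _ _ H]) (auto simp: colour_sample_def)
  have wcong: "wsum p j k l X = wsum p j k l Y" if "\<And>c. c \<noteq> 4 \<Longrightarrow> X c = Y c" for X Y
    using dist that by (simp add: wsum_def)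
  have pos: "0 \<le> \<Phi> \<omega> b1 b2 b3" for \<omega> b1 b2 b3
    unfolding \<Phi>_def using sub by (intro H) (auto simp: colour_sample_def)
  have valid: "colour_weights (copy_weights C p) (V - {x, y, z})"
    using golden_power(3,4) by (intro copy_weights_valid) (auto simp: p_def)
  let ?N = "\<lambda>i c d e. of_bool (c = i) + of_bool (d = i) + of_bool (e = i) :: nat"
  have "colour_expect (copy_weights C p) V (\<lambda>\<omega>. H (colour_sample V j \<omega>) *
      (load (colour_count B j \<omega>) + share (colour_count B j \<omega>) (colour_count B k \<omega>) (colour_count B l \<omega>))) =
    colour_expect (copy_weights C p) (V - {x, y, z}) (\<lambda>\<omega>. wsum p j k l (\<lambda>c. wsum p j k l (\<lambda>d. wsum p j k l (\<lambda>e.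
      \<Phi> \<omega> (c = j) (d = j) (e = j) * (load (?N j c d e) + share (?N j c d e) (?N k c d e) (?N l c d e))))))"
    unfolding E B colour_count_block[OF xyz]
    by (intro colour_expect_cong wcong) (simp only: sample not_False_eq_True)
  also have "\<dots> \<le> colour_expect (copy_weights C p) (V - {x, y, z}) (\<lambda>\<omega>. 27/5 * wsum p j k l (\<lambda>c. wsum p j k l (\<lambda>d.
      wsum p j k l (\<lambda>e. \<Phi> \<omega> (c = j) (d = j) (e = j)))))"
    unfolding p_def using pos dist valid
    by (intro colour_expect_mono three_colour_block) (auto simp: p_def)
  also have "\<dots> = 27/5 * colour_expect (copy_weights C p) V (\<lambda>\<omega>. H (colour_sample V j \<omega>))"
    unfolding E colour_expect_cmult
    by (intro arg_cong[of _ _ "\<lambda>X. 27/5 * X"] colour_expect_cong wcong) (simp only: sample not_False_eq_True)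
  finally show ?thesis .
qed

section \<open>Thinning inside the three samples\<close>

definition kept :: "'a set \<Rightarrow> 'a set set \<Rightarrow> nat set \<Rightarrow> nat \<Rightarrow> ('a \<Rightarrow> nat) \<Rightarrow> 'a set" where
  "kept C \<B> K j \<omega> = {v \<in> C. \<omega> v = j \<and> (\<exists>B\<in>\<B>. v \<in> B \<and> colour_count B j \<omega> \<in> K)}"

definition keep_sets :: "nat \<Rightarrow> nat set" where
  "keep_sets u = (if u = 0 then {1, 2} else {1})"

text \<open>The item needs one of three colours, of total weight \<open>3 * p\<close>. Given its
  colour, the other two items of the block must not both share it when \<open>u = 0\<close>, and
  neither may share it otherwise.\<close>

lemma kept_probability:
  assumes "finite C" "disjoint \<B>" "B \<in> \<B>" "B \<subseteq> C" "v \<in> B" "card B = 3" "0 \<le> p" "3 * p \<le> 1"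
  shows "colour_expect (copy_weights C p) C (\<lambda>\<omega>. of_bool (v \<in> (\<Union>j\<in>{1,2,3}. kept C \<B> (keep_sets u) j \<omega>))) =
    3 * p * (if u = 0 then 1 - p^2 else (1 - p)^2)"
proof -
  obtain x y z where B: "B = {x, y, z}" and xyz: "x \<noteq> y" "x \<noteq> z" "y \<noteq> z" and
    E: "\<And>\<phi>. colour_expect (copy_weights C p) C \<phi> =
      colour_expect (copy_weights C p) (C - {x, y, z}) (\<lambda>\<omega>. wsum p 1 2 3 (\<lambda>c. wsum p 1 2 3 (\<lambda>d. wsum p 1 2 3 (\<lambda>e.
        \<phi> (\<omega>(z := c, y := d, x := e))))))"
    using colour_expect_block[OF assms(1,4) assms(4,6), of 1 2 3 p] by blast
  have "v \<in> B' \<longleftrightarrow> B' = B" if "B' \<in> \<B>" for B'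
    using assms(2,3,5) that by (auto dest: disjointD)
  then have kept: "v \<in> kept C \<B> K j \<omega> \<longleftrightarrow> \<omega> v = j \<and> colour_count {x, y, z} j \<omega> \<in> K" for K j \<omega>
    using assms(3,4,5) B unfolding kept_def by auto
  have valid: "colour_weights (copy_weights C p) (C - {x, y, z})"
    using assms by (intro copy_weights_valid)
  have v: "v = x \<or> v = y \<or> v = z" using assms(5) B by auto
  show ?thesis
    unfolding E UN_iff kept colour_count_block[OF xyz] keep_sets_def
    using v xyz colour_expect_const[OF _ valid] assms(1)
    by (elim disjE) (simp_all add: wsum_def, simp_all add: algebra_simps power2_eq_square)
qed

text \<open>Here \<open>d\<close> tells whether the greedy item of the group lies in the optimum,
  and 7/10, 3/10 are the weights of the coin. The values of \<open>load\<close> are the maxima of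
  the left side over \<open>d\<close>; for instance 26/5 arises at \<open>n = 2\<close>,
  \<open>d = 0\<close>.\<close>

lemma average_load:
  assumes "d \<le> 1" "d \<le> n"
  shows "7/10 * (1 + 2 * real d + 3 * (if n \<in> keep_sets 0 then real (n - d) else 0)) +
    3/10 * (1 + 2 * real d + 3 * (if n \<in> keep_sets 1 then real (n - d) else 0)) \<le> load n"
proof -
  have "d = 0 \<or> d = 1" using assms by auto
  then show ?thesis using assms by (auto simp: load_def keep_sets_def)
qed

section \<open>Joining three greedy sets\<close>

context greedy_instance
begin

lemma marg_le_gain:
  assumes "certificate R A \<gamma> h" "R \<subseteq> V" "A \<subseteq> Y" "Y \<subseteq> V" "i < m" "z \<in> R \<inter> G i" "cap i = 1"
  shows "marg z Y \<le> sum \<gamma> (A \<inter> G i)"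
proof -
  have h: "marg z A \<le> h i" "h i \<le> sum \<gamma> (A \<inter> G i)" "0 \<le> h i"
    using assms by (auto simp: certificate_def)
  show ?thesis
  proof (cases "z \<in> Y")
    case False
    then have "marg z Y \<le> marg z A" using assms by (intro marg_antimono) auto
    then show ?thesis using h by simp
  qed (use h in simp)
qed

text \<open>With capacity 1 the copy has at most one item per group. If it lies outside
  \<open>C\<close>, its marginal at \<open>Y\<close> gives the alternative bound \<open>L\<close>,
  later supplied by the gains of earlier copies; otherwise it pays its own gain.\<close>

lemma add_copy:
  assumes cert: "certificate R A \<gamma> h" and "R \<subseteq> V" "Y \<subseteq> V" and caps: "\<And>i. i < m \<Longrightarrow> cap i = 1"
    and L: "\<And>i z. i < m \<Longrightarrow> z \<in> A \<inter> G i - C \<Longrightarrow> marg z Y \<le> L i" "\<And>i. i < m \<Longrightarrow> 0 \<le> L i"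
  shows "f (Y \<union> A) \<le> f Y + (\<Sum>i<m. if A \<inter> G i \<inter> C = {} then min (sum \<gamma> (A \<inter> G i)) (L i) else sum \<gamma> (A \<inter> G i))"
proof -
  have gains: "greedy_gains R A \<gamma>" and "A \<subseteq> V"
    using cert assms(2) by (auto simp: certificate_def greedy_gains_def)
  have "f (Y \<union> A) \<le> f Y + (\<Sum>z\<in>A. min (\<gamma> z) (marg z Y))"
    using gains assms(3) by (simp add: greedy_gains_def)
  also have "(\<Sum>z\<in>A. min (\<gamma> z) (marg z Y)) = (\<Sum>i<m. \<Sum>z\<in>A \<inter> G i. min (\<gamma> z) (marg z Y))"
    using \<open>A \<subseteq> V\<close> by (rule sum_over_groups)
  also have "\<dots> \<le> (\<Sum>i<m. if A \<inter> G i \<inter> C = {} then min (sum \<gamma> (A \<inter> G i)) (L i) else sum \<gamma> (A \<inter> G i))"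
  proof (intro sum_mono)
    fix i assume i: "i \<in> {..<m}"
    have "card (A \<inter> G i) \<le> 1" using gains caps i by (auto simp: greedy_gains_def semi_feasible_def)
    moreover have "finite (A \<inter> G i)" using \<open>A \<subseteq> V\<close> finite_ground finite_subset by blast
    ultimately consider "A \<inter> G i = {}" | z where "A \<inter> G i = {z}"
      by (metis card_1_singletonE card_0_eq le_antisym less_one linorder_not_less)
    then show "(\<Sum>z\<in>A \<inter> G i. min (\<gamma> z) (marg z Y)) \<le>
        (if A \<inter> G i \<inter> C = {} then min (sum \<gamma> (A \<inter> G i)) (L i) else sum \<gamma> (A \<inter> G i))"
    proof cases
      case 1
      then show ?thesis using L(2) i by simp
    next
      case (2 z)
      then show ?thesis using L(1)[of i z] i by (auto simp: min_le_iff_disj min.coboundedI1)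
    qed
  qed
  finally show ?thesis by simp
qed

text \<open>Outside \<open>C\<close> the later samples are contained in the earlier ones, so an item
  selected there by a later copy was also sampled by the earlier ones, and its marginal is at most
  their gains in the group. The first copy pays in full.\<close>

lemma three_copies_in_order:
  assumes cert: "certificate R1 A1 \<gamma>1 h1" "certificate R2 A2 \<gamma>2 h2" "certificate R3 A3 \<gamma>3 h3"
    and R: "R1 \<subseteq> V" "R2 \<subseteq> V" "R3 \<subseteq> V" "R2 - C \<subseteq> R1" "R3 - C \<subseteq> R1" "R3 - C \<subseteq> R2"
    and caps: "\<And>i. i < m \<Longrightarrow> cap i = 1"
  defines "H1 \<equiv> \<lambda>i. sum \<gamma>1 (A1 \<inter> G i)" and "H2 \<equiv> \<lambda>i. sum \<gamma>2 (A2 \<inter> G i)" and "H3 \<equiv> \<lambda>i. sum \<gamma>3 (A3 \<inter> G i)"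
  shows "f (A1 \<union> A2 \<union> A3) \<le> f {} + (\<Sum>i<m. H1 i + (if A2 \<inter> G i \<inter> C = {} then min (H1 i) (H2 i) else H2 i) +
    (if A3 \<inter> G i \<inter> C = {} then min (H1 i) (min (H2 i) (H3 i)) else H3 i))"
proof -
  have sub: "A1 \<subseteq> R1" "A2 \<subseteq> R2" "A3 \<subseteq> R3" using cert by (auto simp: certificate_def greedy_gains_def)
  then have AV: "A1 \<subseteq> V" "A1 \<union> A2 \<subseteq> V" "A1 \<union> A2 \<union> A3 \<subseteq> V" using R by auto
  have pos: "0 \<le> H1 i" "0 \<le> H2 i" for i
    using cert by (auto simp: certificate_def greedy_gains_def H1_def H2_def less_imp_le intro!: sum_nonneg)
  have "f (A1 \<union> A2 \<union> A3) \<le> f (A1 \<union> A2) + (\<Sum>i<m. if A3 \<inter> G i \<inter> C = {} then min (H3 i) (min (H1 i) (H2 i)) else H3 i)"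
    unfolding H3_def
  proof (rule add_copy[OF cert(3) R(3) AV(2) caps])
    show "marg z (A1 \<union> A2) \<le> min (H1 i) (H2 i)" if "i < m" "z \<in> A3 \<inter> G i - C" for i z
      using that sub R AV marg_le_gain[OF cert(1) R(1) _ AV(2), of i z] marg_le_gain[OF cert(2) R(2) _ AV(2), of i z]
        caps by (auto simp: H1_def H2_def)
  qed (use pos in auto)
  moreover have "f (A1 \<union> A2) \<le> f A1 + (\<Sum>i<m. if A2 \<inter> G i \<inter> C = {} then min (H2 i) (H1 i) else H2 i)"
    unfolding H2_def
  proof (rule add_copy[OF cert(2) R(2) AV(1) caps])
    show "marg z A1 \<le> H1 i" if "i < m" "z \<in> A2 \<inter> G i - C" for i z
      using that sub R AV marg_le_gain[OF cert(1) R(1) _ AV(1), of i z] caps by (auto simp: H1_def)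
  qed (use pos in auto)
  moreover have "f A1 = f {} + (\<Sum>i<m. H1 i)"
    using certificate_gain[OF cert(1) R(1)] by (simp add: H1_def)
  moreover have "(\<Sum>i<m. if A3 \<inter> G i \<inter> C = {} then min (H3 i) (min (H1 i) (H2 i)) else H3 i) =
      (\<Sum>i<m. if A3 \<inter> G i \<inter> C = {} then min (H1 i) (min (H2 i) (H3 i)) else H3 i)"
    "(\<Sum>i<m. if A2 \<inter> G i \<inter> C = {} then min (H2 i) (H1 i) else H2 i) =
      (\<Sum>i<m. if A2 \<inter> G i \<inter> C = {} then min (H1 i) (H2 i) else H2 i)"
    by (intro sum.cong; simp add: min_def)+
  ultimately show ?thesis unfolding sum.distrib by linarith
qed

lemma kept_groups:
  assumes "i < m"
  shows "kept C ((\<lambda>i. C \<inter> G i) ` {..<m}) K j \<omega> \<inter> G i =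
    (if colour_count (C \<inter> G i) j \<omega> \<in> K then {v \<in> C \<inter> G i. \<omega> v = j} else {})"
proof -
  have "i' = i" if "i' < m" "v \<in> G i'" "v \<in> G i" for i' v
    using group_disjoint[OF that(1) assms that(2,3)] .
  then show ?thesis using assms by (auto simp: kept_def)
qed


text \<open>The three cyclic orders of the copies are added up, whence the factor 3. In
  \<open>cost\<close>, 1 stands for the order in which the copy comes first,
  \<open>2 * \<delta>\<close> for the two other orders if its item lies in \<open>C\<close>, and the
  last term for the thinned items, charged once per order.\<close>

lemma three_copies:
  assumes cert: "\<And>j. j \<in> {1,2,3} \<Longrightarrow> certificate (R j) (A j) (\<gamma> j) (h j)"
    and R: "\<And>j. j \<in> {1,2,3} \<Longrightarrow> R j = colour_sample V j \<omega>"
    and caps: "\<And>i. i < m \<Longrightarrow> cap i = 1"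
    and supp: "\<And>v. v \<in> C \<Longrightarrow> \<omega> v \<in> {0,1,2,3}" "\<And>v. v \<in> V - C \<Longrightarrow> \<omega> v \<in> {0,4}" and "C \<subseteq> V"
  defines "H \<equiv> \<lambda>j i. sum (\<gamma> j) (A j \<inter> G i)" and "n \<equiv> \<lambda>j i. colour_count (C \<inter> G i) j \<omega>"
    and "\<delta> \<equiv> \<lambda>j i. of_bool (A j \<inter> G i \<inter> C \<noteq> {}) :: nat"
  defines "T \<equiv> \<lambda>u j. kept C ((\<lambda>i. C \<inter> G i) ` {..<m}) (keep_sets u) j \<omega>"
    and "cost \<equiv> \<lambda>u j i. 1 + 2 * real (\<delta> j i) + 3 * (if n j i \<in> keep_sets u then real (n j i - \<delta> j i) else 0)"
  shows "3 * f (A 1 \<union> A 2 \<union> A 3 \<union> (T u 1 \<union> T u 2 \<union> T u 3)) \<le> 3 * f {} + (\<Sum>i<m.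
      H 1 i * (cost u 1 i + share (n 1 i) (n 2 i) (n 3 i)) +
      H 2 i * (cost u 2 i + share (n 2 i) (n 3 i) (n 1 i)) +
      H 3 i * (cost u 3 i + share (n 3 i) (n 1 i) (n 2 i)))"
    and "j \<in> {1,2,3} \<Longrightarrow> i < m \<Longrightarrow> \<delta> j i \<le> n j i"
proof -
  have sub: "A j \<subseteq> R j" if "j \<in> {1,2,3}" for j
    using cert[OF that] by (auto simp: certificate_def greedy_gains_def)
  have RV: "R j \<subseteq> V" if "j \<in> {1,2,3}" for j using R[OF that] by (auto simp: colour_sample_def)
  have RC: "R j - C \<subseteq> R k" if "j \<in> {1,2,3}" "k \<in> {1,2,3}" for j k
  proof
    fix v assume v: "v \<in> R j - C"
    then have "v \<in> V" "\<omega> v = j \<or> \<omega> v = 4" using R[OF that(1)] by (auto simp: colour_sample_def)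
    then have "\<omega> v = 4" using supp(2)[of v] v that(1) by auto
    then show "v \<in> R k" using R[OF that(2)] \<open>v \<in> V\<close> by (simp add: colour_sample_def)
  qed
  have TR: "T u j \<subseteq> R j" if "j \<in> {1,2,3}" for j
    using R[OF that] \<open>C \<subseteq> V\<close> by (auto simp: T_def kept_def colour_sample_def)
  have pos: "0 \<le> H j i" if "j \<in> {1,2,3}" for i j
    using cert[OF that] by (auto simp: certificate_def greedy_gains_def H_def less_imp_le intro!: sum_nonneg)
  have finG: "finite (A j \<inter> G i)" "finite {v \<in> C \<inter> G i. \<omega> v = j}" if "j \<in> {1,2,3}" for i j
    using sub[OF that] RV[OF that] \<open>C \<subseteq> V\<close> by (auto intro: finite_subset[OF _ finite_ground])
  \<comment> \<open>Colour 4 does not occur inside \<open>C\<close>, so a selected item of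
    \<open>C\<close> has colour \<open>j\<close> and is among the \<open>n j i\<close> counted
    ones.\<close>
  have own: "A j \<inter> G i \<inter> C \<subseteq> {v \<in> C \<inter> G i. \<omega> v = j}" if "j \<in> {1,2,3}" for i j
    using sub[OF that] supp(1) R[OF that] by (fastforce simp: colour_sample_def)
  show \<delta>n: "\<delta> j i \<le> n j i" if "j \<in> {1,2,3}" for i j
  proof (cases "A j \<inter> G i \<inter> C = {}")
    case False
    then have "{v \<in> C \<inter> G i. \<omega> v = j} \<noteq> {}" using own[OF that, of i] by blast
    then show ?thesis using finG(2)[OF that, of i] False by (simp add: \<delta>_def n_def Suc_le_eq card_gt_0_iff)
  qed (simp add: \<delta>_def)
  define c where "c j i = (if n j i \<in> keep_sets u then real (n j i - \<delta> j i) else 0)" for j i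
  have charge: "(\<Sum>i<m. real (card (T u j \<inter> G i - A j)) * h j i) \<le>
      (\<Sum>i<m. c j i * H j i)" if j: "j \<in> {1,2,3}" for j
  proof (intro sum_mono)
    fix i assume i: "i \<in> {..<m}"
    have h: "0 \<le> h j i" "h j i \<le> H j i" using cert[OF j] caps i by (auto simp: certificate_def H_def)
    have "card (T u j \<inter> G i - A j) \<le> (if n j i \<in> keep_sets u then n j i - \<delta> j i else 0)"
    proof (cases "n j i \<in> keep_sets u")
      case True
      then have "T u j \<inter> G i = {v \<in> C \<inter> G i. \<omega> v = j}"
        using kept_groups[of i C "keep_sets u" j \<omega>] i by (simp add: T_def n_def)
      \<comment> \<open>An item already selected adds nothing, so one sampled item is free when the
        greedy item lies in \<open>C\<close>.\<close>
      moreover have "card ({v \<in> C \<inter> G i. \<omega> v = j} - A j) \<le> n j i - \<delta> j i"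
      proof (cases "A j \<inter> G i \<inter> C = {}")
        case False
        then obtain z where z: "z \<in> A j \<inter> G i \<inter> C" by blast
        then have "z \<in> {v \<in> C \<inter> G i. \<omega> v = j}" using own[OF j, of i] by blast
        then have "card ({v \<in> C \<inter> G i. \<omega> v = j} - {z}) = n j i - 1" using finG(2)[OF j] by (simp add: n_def)
        moreover have "card ({v \<in> C \<inter> G i. \<omega> v = j} - A j) \<le> card ({v \<in> C \<inter> G i. \<omega> v = j} - {z})"
          using finG(2)[OF j] z by (intro card_mono) auto
        ultimately show ?thesis using False by (simp add: \<delta>_def)
      next
        case True
        then show ?thesis using finG(2)[OF j, of i] by (auto simp: \<delta>_def n_def intro!: card_mono)
      qed
      ultimately show ?thesis using True by simp
    next
      case False
      then have "T u j \<inter> G i = {}"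
        using kept_groups[of i C "keep_sets u" j \<omega>] i by (simp add: T_def n_def)
      then show ?thesis by simp
    qed
    then have "real (card (T u j \<inter> G i - A j)) \<le> c j i" "0 \<le> c j i"
      by (auto simp: c_def split: if_splits)
    then show "real (card (T u j \<inter> G i - A j)) * h j i \<le> c j i * H j i"
      using h by (intro mult_mono) auto
  qed
  let ?U = "A 1 \<union> A 2 \<union> A 3"
  have UV: "?U \<subseteq> V" using sub RV by blast
  have TV: "T u j \<subseteq> V" if "j \<in> {1,2,3}" for j using TR RV that by blast
  have charged: "f (?U \<union> T u 1 \<union> T u 2 \<union> T u 3) \<le> f ?U + (\<Sum>i<m. c 1 i * H 1 i) + (\<Sum>i<m. c 2 i * H 2 i) + (\<Sum>i<m. c 3 i * H 3 i)"
  proof -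
    have step: "f (W \<union> T u j) \<le> f W + (\<Sum>i<m. c j i * H j i)" if "j \<in> {1,2,3}" "A j \<subseteq> W" "W \<subseteq> V" for j W
      using union_le_charges[OF cert[OF that(1)] RV[OF that(1)] that(2,3) TR[OF that(1)]] charge[OF that(1)] by linarith
    have "f (?U \<union> T u 1) \<le> f ?U + (\<Sum>i<m. c 1 i * H 1 i)"
      by (rule step) (use UV in auto)
    moreover have "f (?U \<union> T u 1 \<union> T u 2) \<le> f (?U \<union> T u 1) + (\<Sum>i<m. c 2 i * H 2 i)"
      by (rule step) (use UV TV[of 1] in auto)
    moreover have "f (?U \<union> T u 1 \<union> T u 2 \<union> T u 3) \<le> f (?U \<union> T u 1 \<union> T u 2) + (\<Sum>i<m. c 3 i * H 3 i)"
      by (rule step) (use UV TV[of 1] TV[of 2] in auto)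
    ultimately show ?thesis by linarith
  qed
  have unshared: "3 * f ?U \<le> 3 * f {} + (\<Sum>i<m. H 1 i * (1 + 2 * real (\<delta> 1 i) + share (n 1 i) (n 2 i) (n 3 i)) +
      H 2 i * (1 + 2 * real (\<delta> 2 i) + share (n 2 i) (n 3 i) (n 1 i)) +
      H 3 i * (1 + 2 * real (\<delta> 3 i) + share (n 3 i) (n 1 i) (n 2 i)))"
  proof -
    let ?d = "\<lambda>j i. A j \<inter> G i \<inter> C = {}"
    let ?B = "\<lambda>a b c i. H a i + (if ?d b i then min (H a i) (H b i) else H b i) +
        (if ?d c i then min (H a i) (min (H b i) (H c i)) else H c i)"
    have order: "f (A a \<union> A b \<union> A c) \<le> f {} + sum (?B a b c) {..<m}" if "a \<in> {1,2,3}" "b \<in> {1,2,3}" "c \<in> {1,2,3}" for a b c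
      unfolding H_def
      by (rule three_copies_in_order[OF cert cert cert]) (use that RV RC caps in auto)
    have perm: "A 2 \<union> A 3 \<union> A 1 = ?U" "A 3 \<union> A 1 \<union> A 2 = ?U" by auto
    have "3 * f ?U \<le> 3 * f {} + (\<Sum>i<m. ?B 1 2 3 i + ?B 2 3 1 i + ?B 3 1 2 i)"
    proof -
      have "f ?U \<le> f {} + sum (?B 1 2 3) {..<m}" by (rule order) auto
      moreover have "f ?U \<le> f {} + sum (?B 2 3 1) {..<m}"
        by (subst perm(1)[symmetric], rule order) auto
      moreover have "f ?U \<le> f {} + sum (?B 3 1 2) {..<m}"
        by (subst perm(2)[symmetric], rule order) auto
      moreover have "(\<Sum>i<m. ?B 1 2 3 i + ?B 2 3 1 i + ?B 3 1 2 i) =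
          sum (?B 1 2 3) {..<m} + sum (?B 2 3 1) {..<m} + sum (?B 3 1 2) {..<m}"
        by (simp only: sum.distrib)
      ultimately show ?thesis by linarith
    qed
    also have "\<dots> \<le> 3 * f {} + (\<Sum>i<m. H 1 i * (1 + 2 * real (\<delta> 1 i) + share (n 1 i) (n 2 i) (n 3 i)) +
      H 2 i * (1 + 2 * real (\<delta> 2 i) + share (n 2 i) (n 3 i) (n 1 i)) +
      H 3 i * (1 + 2 * real (\<delta> 3 i) + share (n 3 i) (n 1 i) (n 2 i)))"
    proof (intro add_left_mono sum_mono)
      fix i
      define x y z where "x = H 1 i" and "y = H 2 i" and "z = H 3 i"
      have xyz: "0 \<le> x" "0 \<le> y" "0 \<le> z" using pos by (auto simp: x_def y_def z_def)
      have m3: "min y (min z x) = min x (min y z)" "min z (min x y) = min x (min y z)" by (auto simp: min_def)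
      have nn: "0 \<le> min x y" "0 \<le> min y z" "0 \<le> min z x" "0 \<le> min x (min y z)" using xyz by auto
      \<comment> \<open>If the item of a copy lies in \<open>C\<close>, full gains replace the two
        minima of that copy; the minima on the right then only help, being nonnegative.\<close>
      have "?B 1 2 3 i + ?B 2 3 1 i + ?B 3 1 2 i \<le> x * (1 + 2 * real (\<delta> 1 i)) + y * (1 + 2 * real (\<delta> 2 i)) + z * (1 + 2 * real (\<delta> 3 i)) +
          (min x y + min y z + min z x + 3 * min x (min y z))"
        unfolding x_def[symmetric] y_def[symmetric] z_def[symmetric] m3 \<delta>_def using nn by (auto simp: algebra_simps)
      also have "\<dots> \<le> x * (1 + 2 * real (\<delta> 1 i)) + y * (1 + 2 * real (\<delta> 2 i)) + z * (1 + 2 * real (\<delta> 3 i)) +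
          (x * share (n 1 i) (n 2 i) (n 3 i) + y * share (n 2 i) (n 3 i) (n 1 i) + z * share (n 3 i) (n 1 i) (n 2 i))"
        by (intro add_left_mono mins_le_shares)
      finally show "?B 1 2 3 i + ?B 2 3 1 i + ?B 3 1 2 i \<le> H 1 i * (1 + 2 * real (\<delta> 1 i) + share (n 1 i) (n 2 i) (n 3 i)) +
        H 2 i * (1 + 2 * real (\<delta> 2 i) + share (n 2 i) (n 3 i) (n 1 i)) +
        H 3 i * (1 + 2 * real (\<delta> 3 i) + share (n 3 i) (n 1 i) (n 2 i))"
        by (simp add: x_def y_def z_def algebra_simps)
    qed
    finally show ?thesis .
  qed
  have "3 * f (?U \<union> T u 1 \<union> T u 2 \<union> T u 3) \<le> 3 * f {} + (\<Sum>i<m. H 1 i * (1 + 2 * real (\<delta> 1 i) + share (n 1 i) (n 2 i) (n 3 i)) +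
      H 2 i * (1 + 2 * real (\<delta> 2 i) + share (n 2 i) (n 3 i) (n 1 i)) +
      H 3 i * (1 + 2 * real (\<delta> 3 i) + share (n 3 i) (n 1 i) (n 2 i))) +
      3 * ((\<Sum>i<m. c 1 i * H 1 i) + (\<Sum>i<m. c 2 i * H 2 i) + (\<Sum>i<m. c 3 i * H 3 i))"
    proof -
    have "a \<le> b + x + y + z \<Longrightarrow> 3 * b \<le> d \<Longrightarrow> 3 * a \<le> d + 3 * (x + y + z)" for a b d x y z :: real by simp
    then show ?thesis using charged unshared by blast
  qed
  also have "\<dots> = 3 * f {} + (\<Sum>i<m.
      H 1 i * (cost u 1 i + share (n 1 i) (n 2 i) (n 3 i)) +
      H 2 i * (cost u 2 i + share (n 2 i) (n 3 i) (n 1 i)) +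
      H 3 i * (cost u 3 i + share (n 3 i) (n 1 i) (n 2 i)))"
    unfolding cost_def c_def[symmetric] by (simp add: sum.distrib sum_distrib_left distrib_left distrib_right mult.assoc mult.left_commute mult.commute)
  finally show "3 * f (?U \<union> (T u 1 \<union> T u 2 \<union> T u 3)) \<le> 3 * f {} + (\<Sum>i<m.
      H 1 i * (cost u 1 i + share (n 1 i) (n 2 i) (n 3 i)) +
      H 2 i * (cost u 2 i + share (n 2 i) (n 3 i) (n 1 i)) +
      H 3 i * (cost u 3 i + share (n 3 i) (n 1 i) (n 2 i)))"
    by (simp add: Un_assoc)
qed


text \<open>The three greedy sets together with the thinned items cover each item of
  \<open>C\<close> at rate \<open>t\<close>. From above, each copy contributes at most 27/5 times
  the expected gains, and the factor 1/3 from the cyclic orders cancels the number of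
  copies.\<close>

lemma greedy_value_three_copies:
  fixes C :: "'a set"
  defines "p \<equiv> (sqrt 5 - 1) / 4"
  assumes cert: "\<And>R. R \<subseteq> V \<Longrightarrow> certificate R (A R) (\<gamma> R) (h R)"
    and "C \<subseteq> V" and card: "\<And>i. i < m \<Longrightarrow> card (C \<inter> G i) = 3" and caps: "\<And>i. i < m \<Longrightarrow> cap i = 1"
  shows "9/100 * f C \<le> sample_expect V p (\<lambda>R. f (A R))"
proof -
  note p = golden_power[folded p_def]
  define q where "q = copy_weights C p"
  define Rj where "Rj = colour_sample V"
  have Rj: "Rj j \<omega> \<subseteq> V" for j \<omega> by (auto simp: Rj_def colour_sample_def)
  have q: "colour_weights q W" for W
    unfolding q_def using p by (intro copy_weights_valid) auto
  have marginal: "colour_expect q V (\<lambda>\<omega>. \<phi> (Rj j \<omega>)) = sample_expect V p \<phi>" if "j \<in> {1,2,3}" for j \<phi>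
    unfolding Rj_def using that p copy_weights_valid(2)[of p j C] q
    by (intro colour_expect_sample[OF finite_ground]) (auto simp: q_def)
  define \<B> where "\<B> = (\<lambda>i. C \<inter> G i) ` {..<m}"
  define T where "T u \<omega> = (\<Union>j\<in>{1,2,3}. kept C \<B> (keep_sets u) j \<omega>)" for u \<omega>
  define S where "S u \<omega> = A (Rj 1 \<omega>) \<union> A (Rj 2 \<omega>) \<union> A (Rj 3 \<omega>) \<union> T u \<omega>" for u \<omega>
  define w where "w u = (if u = 0 then 7/10 else 3/10 :: real)" for u :: nat
  define H where "H i R = sum (\<gamma> R) (A R \<inter> G i)" for i R
  have AR: "A R \<subseteq> R" if "R \<subseteq> V" for R
    using cert[OF that] by (auto simp: certificate_def greedy_gains_def)
  have disj: "disjoint \<B>"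
    unfolding \<B>_def disjoint_def using group_disjoint by blast
  \<comment> \<open>Covering rate of the union of the three thinned samples, averaged over the
    coin.\<close>
  define t where "t = 7/10 * (3 * p * (1 - p^2)) + 3/10 * (3 * p * (1 - p)^2)"
  have t_eq: "t = 3 * p - 18/10 * p^2 - 12/10 * p^3"
    by (simp add: t_def field_simps power2_eq_square power3_eq_cube)
  have "0 \<le> t" "t \<le> 1" using p t_eq by linarith+
  have "(1 - p) * t * f C \<le> (\<Sum>u\<in>{0,1}. w u * colour_expect q V (\<lambda>\<omega>. f (S u \<omega>)))"
  proof (rule expected_value_bound[where T = T])
    show "T u \<omega> = T u \<omega>'" if "\<And>v. v \<in> C \<Longrightarrow> \<omega> v = \<omega>' v" for u \<omega> \<omega>'
    proof -
      have "{v \<in> B. \<omega> v = j} = {v \<in> B. \<omega>' v = j}" if "B \<in> \<B>" for B j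
        using that \<open>\<And>v. v \<in> C \<Longrightarrow> \<omega> v = \<omega>' v\<close> by (auto simp: \<B>_def)
      then show ?thesis using that by (auto simp: T_def kept_def)
    qed
    show "T u \<omega> \<subseteq> C \<and> T u \<omega> \<subseteq> S u \<omega> \<and> S u \<omega> \<subseteq> V" for u \<omega>
      using AR[OF Rj] Rj \<open>C \<subseteq> V\<close> unfolding T_def S_def kept_def by blast
    show "\<omega> v \<noteq> 0" if "v \<in> S u \<omega> - C" for u \<omega> v
      using that AR[OF Rj, of _ \<omega>] by (fastforce simp: T_def S_def kept_def Rj_def colour_sample_def)
    show "q v 0 = 1 - p" if "v \<in> V - C" for v using that by (simp add: q_def copy_weights_def)
    fix v assume "v \<in> C"
    then obtain i where i: "i < m" "v \<in> C \<inter> G i" using group_exists[of v] \<open>C \<subseteq> V\<close> by blast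
    have "colour_expect q C (\<lambda>\<omega>. of_bool (v \<in> T u \<omega>)) = 3 * p * (if u = 0 then 1 - p^2 else (1 - p)^2)" for u
      unfolding q_def T_def
      using i card p disj finite_subset[OF \<open>C \<subseteq> V\<close> finite_ground]
      by (intro kept_probability[where B = "C \<inter> G i"]) (auto simp: \<B>_def)
    then show "t \<le> (\<Sum>u\<in>{0,1}. w u * colour_expect q C (\<lambda>\<omega>. of_bool (v \<in> T u \<omega>)))"
      by (simp add: w_def t_def)
  qed (use q \<open>C \<subseteq> V\<close> p \<open>0 \<le> t\<close> \<open>t \<le> 1\<close> in \<open>auto simp: w_def\<close>)
  also have "\<dots> = colour_expect q V (\<lambda>\<omega>. 7/10 * f (S 0 \<omega>) + 3/10 * f (S 1 \<omega>))"
    unfolding colour_expect_add colour_expect_cmult by (simp add: w_def)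
  also have "\<dots> \<le> colour_expect q V (\<lambda>\<omega>. f {} + 1/3 * (\<Sum>i<m.
      H i (Rj 1 \<omega>) * (load (colour_count (C \<inter> G i) 1 \<omega>) + share (colour_count (C \<inter> G i) 1 \<omega>) (colour_count (C \<inter> G i) 2 \<omega>) (colour_count (C \<inter> G i) 3 \<omega>)) +
      H i (Rj 2 \<omega>) * (load (colour_count (C \<inter> G i) 2 \<omega>) + share (colour_count (C \<inter> G i) 2 \<omega>) (colour_count (C \<inter> G i) 3 \<omega>) (colour_count (C \<inter> G i) 1 \<omega>)) +
      H i (Rj 3 \<omega>) * (load (colour_count (C \<inter> G i) 3 \<omega>) + share (colour_count (C \<inter> G i) 3 \<omega>) (colour_count (C \<inter> G i) 1 \<omega>) (colour_count (C \<inter> G i) 2 \<omega>))))"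
    (is "_ \<le> colour_expect q V (\<lambda>\<omega>. f {} + 1/3 * (\<Sum>i<m. ?X 1 2 3 i \<omega> + ?X 2 3 1 i \<omega> + ?X 3 1 2 i \<omega>))")
  \<comment> \<open>Only colourings of positive weight matter; on them \<open>C\<close> carries the
    colours 0 to 3 and its complement the colours 0 and 4.\<close>
  proof (rule colour_expect_mono_support[OF q _ finite_ground])
    fix \<omega> assume nz: "\<And>v. v \<in> V \<Longrightarrow> q v (\<omega> v) \<noteq> 0"
    have supp: "\<omega> v \<in> {0,1,2,3}" if "v \<in> C" for v
      using nz[of v] that \<open>C \<subseteq> V\<close> by (auto simp: q_def copy_weights_def split: if_splits)
    have supp': "\<omega> v \<in> {0,4}" if "v \<in> V - C" for v
      using nz[of v] that by (auto simp: q_def copy_weights_def split: if_splits)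
    define \<delta> where "\<delta> j i = (of_bool (A (Rj j \<omega>) \<inter> G i \<inter> C \<noteq> {}) :: nat)" for j i
    define n where "n j i = colour_count (C \<inter> G i) j \<omega>" for j i
    define cost where "cost u j i = 1 + 2 * real (\<delta> j i) + 3 * (if n j i \<in> keep_sets u then real (n j i - \<delta> j i) else 0)" for u j i
    note copies = three_copies[where R = "\<lambda>j. Rj j \<omega>" and A = "\<lambda>j. A (Rj j \<omega>)" and \<gamma> = "\<lambda>j. \<gamma> (Rj j \<omega>)" and h = "\<lambda>j. h (Rj j \<omega>)",
        OF cert[OF Rj] _ caps supp supp' \<open>C \<subseteq> V\<close>, unfolded Rj_def, OF refl, folded Rj_def]
    have le: "3 * f (S u \<omega>) \<le> 3 * f {} + (\<Sum>i<m.
      H i (Rj 1 \<omega>) * (cost u 1 i + share (n 1 i) (n 2 i) (n 3 i)) +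
      H i (Rj 2 \<omega>) * (cost u 2 i + share (n 2 i) (n 3 i) (n 1 i)) +
      H i (Rj 3 \<omega>) * (cost u 3 i + share (n 3 i) (n 1 i) (n 2 i)))" for u
    proof -
      have T_eq: "T u \<omega> = kept C \<B> (keep_sets u) 1 \<omega> \<union> kept C \<B> (keep_sets u) 2 \<omega> \<union> kept C \<B> (keep_sets u) 3 \<omega>"
        by (auto simp: T_def)
      show ?thesis
        unfolding S_def T_eq H_def cost_def n_def \<delta>_def \<B>_def by (rule copies(1))
    qed
    have \<delta>n: "\<delta> j i \<le> n j i" if "j \<in> {1,2,3}" "i < m" for j i
      unfolding \<delta>_def n_def by (rule copies(2)) (use that in auto)
    have avg: "7/10 * cost 0 j i + 3/10 * cost 1 j i \<le> load (n j i)" if "j \<in> {1,2,3}" "i < m" for j i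
      unfolding cost_def using \<delta>n[OF that] by (intro average_load) (auto simp: \<delta>_def)
    have pos: "0 \<le> H i (Rj j \<omega>)" for i j
      using cert[OF Rj, of j \<omega>] by (auto simp: H_def certificate_def greedy_gains_def less_imp_le intro!: sum_nonneg)
    have "7/10 * f (S 0 \<omega>) + 3/10 * f (S 1 \<omega>) \<le> f {} + 1/3 * (\<Sum>i<m.
      H i (Rj 1 \<omega>) * ((7/10 * cost 0 1 i + 3/10 * cost 1 1 i) + share (n 1 i) (n 2 i) (n 3 i)) +
      H i (Rj 2 \<omega>) * ((7/10 * cost 0 2 i + 3/10 * cost 1 2 i) + share (n 2 i) (n 3 i) (n 1 i)) +
      H i (Rj 3 \<omega>) * ((7/10 * cost 0 3 i + 3/10 * cost 1 3 i) + share (n 3 i) (n 1 i) (n 2 i)))" (is "_ \<le> f {} + 1/3 * ?Y")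
    proof -
      have Y: "?Y = 7/10 * (\<Sum>i<m.
          H i (Rj 1 \<omega>) * (cost 0 1 i + share (n 1 i) (n 2 i) (n 3 i)) +
          H i (Rj 2 \<omega>) * (cost 0 2 i + share (n 2 i) (n 3 i) (n 1 i)) +
          H i (Rj 3 \<omega>) * (cost 0 3 i + share (n 3 i) (n 1 i) (n 2 i))) + 3/10 * (\<Sum>i<m.
          H i (Rj 1 \<omega>) * (cost 1 1 i + share (n 1 i) (n 2 i) (n 3 i)) +
          H i (Rj 2 \<omega>) * (cost 1 2 i + share (n 2 i) (n 3 i) (n 1 i)) +
          H i (Rj 3 \<omega>) * (cost 1 3 i + share (n 3 i) (n 1 i) (n 2 i)))"
        unfolding sum_distrib_left sum.distrib[symmetric] by (intro sum.cong refl) (simp add: algebra_simps)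
      have "3 * a \<le> 3 * d + x \<Longrightarrow> 3 * b \<le> 3 * d + y \<Longrightarrow>
          7/10 * a + 3/10 * b \<le> d + 1/3 * (7/10 * x + 3/10 * y)" for a b d x y :: real
        by (simp add: field_simps)
      then show ?thesis using le[of 0] le[of 1] unfolding Y by blast
    qed
    also have "\<dots> \<le> f {} + 1/3 * (\<Sum>i<m. ?X 1 2 3 i \<omega> + ?X 2 3 1 i \<omega> + ?X 3 1 2 i \<omega>)"
      unfolding n_def[symmetric]
      by (intro add_left_mono mult_left_mono sum_mono add_mono add_right_mono avg pos) auto
    finally show "7/10 * f (S 0 \<omega>) + 3/10 * f (S 1 \<omega>) \<le> f {} + 1/3 * (\<Sum>i<m. ?X 1 2 3 i \<omega> + ?X 2 3 1 i \<omega> + ?X 3 1 2 i \<omega>)" .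
  qed
  also have "\<dots> = f {} + 1/3 * (\<Sum>i<m. colour_expect q V (?X 1 2 3 i) + colour_expect q V (?X 2 3 1 i) + colour_expect q V (?X 3 1 2 i))"
    by (simp only: colour_expect_add colour_expect_cmult colour_expect_sum colour_expect_const[OF finite_ground q])
  also have "\<dots> \<le> f {} + 1/3 * (\<Sum>i<m. 27/5 * sample_expect V p (H i) + 27/5 * sample_expect V p (H i) + 27/5 * sample_expect V p (H i))"
  proof -
    have "colour_expect q V (?X j k l i) \<le> 27/5 * sample_expect V p (H i)" if "i < m" "{j, k, l} = {1,2,3}" for i j k l
    proof -
      have "0 \<le> H i R" if "R \<subseteq> V" for R
        using cert[OF that] by (auto simp: H_def certificate_def greedy_gains_def less_imp_le intro!: sum_nonneg)
      then have "colour_expect q V (?X j k l i) \<le> 27/5 * colour_expect q V (\<lambda>\<omega>. H i (Rj j \<omega>))"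
        unfolding q_def p_def Rj_def using card[OF that(1)] \<open>C \<subseteq> V\<close> that(2)
        by (intro expected_load_bound[OF finite_ground]) auto
      moreover have "j \<in> {1,2,3}" using that(2) by blast
      ultimately show ?thesis using marginal[of j "H i"] by simp
    qed
    then show ?thesis by (intro add_left_mono mult_left_mono sum_mono add_mono) auto
  qed
  also have "\<dots> = f {} + 27/5 * (\<Sum>i<m. sample_expect V p (H i))"
    by (simp add: sum_distrib_left sum.distrib)
  also have "(\<Sum>i<m. sample_expect V p (H i)) = sample_expect V p (\<lambda>R. f (A R)) - f {}"
  proof -
    have "(\<Sum>i<m. sample_expect V p (H i)) = sample_expect V p (\<lambda>R. \<Sum>i<m. H i R)"
      unfolding sample_expect_def by (simp add: sum_distrib_left sum.swap[of _ "Pow V"])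
    also have "\<dots> = sample_expect V p (\<lambda>R. f (A R) - f {})"
      unfolding sample_expect_def H_def using certificate_gain[OF cert] by (intro sum.cong) auto
    also have "\<dots> = colour_expect q V (\<lambda>\<omega>. f (A (Rj 1 \<omega>)) + - f {})"
      using marginal[of 1 "\<lambda>R. f (A R) - f {}"] by simp
    also have "\<dots> = sample_expect V p (\<lambda>R. f (A R)) - f {}"
      using marginal[of 1 "\<lambda>R. f (A R)"] by (simp only: colour_expect_add colour_expect_const[OF finite_ground q]) simp
    finally show ?thesis .
  qed
  finally have main: "(1 - p) * t * f C \<le> f {} + 27/5 * (sample_expect V p (\<lambda>R. f (A R)) - f {})" .
  \<comment> \<open>\<open>243/500 = 27/5 * 9/100\<close> is the value needed against the charge
    factor 27/5.\<close>
  have "243/500 \<le> (1 - p) * t"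
  proof -
    have "(1 - p) * t = 3 * p - 48/10 * p^2 + 6/10 * p^3 + 12/10 * (p * p^3)"
      by (simp add: t_eq field_simps power2_eq_square power3_eq_cube)
    also have "12/10 * (p * p^3) = 3/5 * p^2 - 3/20 * p"
      by (simp add: p(2) power2_eq_square field_simps)
    finally show ?thesis using p by linarith
  qed
  then have "243/500 * f C \<le> (1 - p) * t * f C"
    using nonneg[OF \<open>C \<subseteq> V\<close>] by (intro mult_right_mono)
  then have "243/500 * f C \<le> f {} + 27/5 * (sample_expect V p (\<lambda>R. f (A R)) - f {})"
    using main by (rule order_trans)
  then show ?thesis using nonneg[of "{}"] by (simp add: right_diff_distrib)
qed

end

section \<open>Charges of a blockwise thinned sample\<close>

text \<open>Only copy 1 is used here. Sampling by colour 1 inside \<open>C\<close> and by colour 4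
  outside lets \<open>\<omega> v = 1\<close> single out the sampled items of
  \<open>C\<close>.\<close>

definition single_weights :: "'a set \<Rightarrow> real \<Rightarrow> 'a \<Rightarrow> nat \<Rightarrow> real" where
  "single_weights C p v c = (if c = (if v \<in> C then 1 else 4) then p else if c = 0 then 1 - p else 0)"

lemma single_weights_valid:
  assumes "0 \<le> p" "p \<le> 1"
  shows "colour_weights (single_weights C p) V"
    and "single_weights C p v 1 + single_weights C p v 4 = p"
  using assms by (auto simp: colour_weights_def single_weights_def sum_lessThan_5)

text \<open>Mean of \<open>F X\<close> for a binomial \<open>X\<close> with \<open>k\<close> trials
  of bias \<open>p\<close>, in a recursive form that can be evaluated for numerals
  \<open>k\<close>.\<close>

primrec binomial_average :: "real \<Rightarrow> nat \<Rightarrow> (nat \<Rightarrow> real) \<Rightarrow> real" where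
  "binomial_average p 0 F = F 0"
| "binomial_average p (Suc k) F = p * binomial_average p k (\<lambda>n. F (Suc n)) + (1 - p) * binomial_average p k F"

lemma single_expect_split:
  assumes "finite C" "x \<in> C" "B \<subseteq> C - {x}"
  shows "colour_expect (single_weights C p) C (\<lambda>\<omega>. \<Psi> (\<omega> x = 1) (colour_count B 1 \<omega>)) =
    colour_expect (single_weights C p) (C - {x}) (\<lambda>\<omega>. p * \<Psi> True (colour_count B 1 \<omega>) + (1 - p) * \<Psi> False (colour_count B 1 \<omega>))"
proof -
  have C: "C = insert x (C - {x})" using assms by auto
  have "colour_count B j (\<omega>(x := c)) = colour_count B j \<omega>" for \<omega> c j
    using assms(3) by (intro arg_cong[of _ _ card]) auto
  then show ?thesis
    using assms by (subst C, subst colour_expect_insert') (auto simp: sum_lessThan_5 single_weights_def add.commute)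
qed

lemma colour_count_binomial:
  assumes "finite D" "B \<subseteq> D" "D \<subseteq> C" "0 \<le> p" "p \<le> 1"
  shows "colour_expect (single_weights C p) D (\<lambda>\<omega>. F (colour_count B 1 \<omega>)) = binomial_average p (card B) F"
proof -
  have "finite B" using assms(1,2) finite_subset by blast
  then show ?thesis using assms
  proof (induction B arbitrary: D F)
    case empty
    then show ?case using colour_expect_const[OF _ single_weights_valid(1)] by simp
  next
    case (insert x B)
    have D: "D = insert x (D - {x})" using insert.prems by auto
    have xB: "{v \<in> insert x B. (\<omega>(x := c)) v = 1} = (if c = 1 then insert x {v \<in> B. \<omega> v = 1} else {v \<in> B. \<omega> v = 1})" for \<omega> c
      using insert.hyps by auto
    have "colour_count (insert x B) 1 (\<omega>(x := c)) = (if c = 1 then Suc (colour_count B 1 \<omega>) else colour_count B 1 \<omega>)" for \<omega> c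
      unfolding xB using insert.hyps by simp
    then have "colour_expect (single_weights C p) D (\<lambda>\<omega>. F (colour_count (insert x B) 1 \<omega>)) =
        colour_expect (single_weights C p) (D - {x}) (\<lambda>\<omega>. p * F (Suc (colour_count B 1 \<omega>)) + (1 - p) * F (colour_count B 1 \<omega>))"
      using insert.prems insert.hyps
      by (subst D, subst colour_expect_insert') (auto simp: sum_lessThan_5 single_weights_def add.commute)
    also have "\<dots> = p * colour_expect (single_weights C p) (D - {x}) (\<lambda>\<omega>. F (Suc (colour_count B 1 \<omega>))) +
        (1 - p) * colour_expect (single_weights C p) (D - {x}) (\<lambda>\<omega>. F (colour_count B 1 \<omega>))"
      by (simp only: colour_expect_add colour_expect_cmult)
    also have "\<dots> = p * binomial_average p (card B) (\<lambda>n. F (Suc n)) + (1 - p) * binomial_average p (card B) F"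
    proof -
      have "B \<subseteq> D - {x}" "D - {x} \<subseteq> C" "finite (D - {x})" using insert.prems insert.hyps by auto
      then show ?thesis using insert.prems(4,5) by (simp del: One_nat_def add: insert.IH[of _ F] insert.IH[of _ "\<lambda>n. F (Suc n)"])
    qed
    finally show ?case using insert.hyps by simp
  qed
qed

text \<open>Given that \<open>x\<close> is sampled, the other items of its block have a binomial
  count, to which \<open>x\<close> itself adds the \<open>Suc\<close>.\<close>

lemma block_member_expect:
  assumes "finite C" "B \<subseteq> C" "x \<in> B" "0 \<le> p" "p \<le> 1"
  shows "colour_expect (single_weights C p) C (\<lambda>\<omega>. of_bool (\<omega> x = 1 \<and> Q (colour_count B 1 \<omega>))) =
    p * binomial_average p (card B - 1) (\<lambda>n. of_bool (Q (Suc n)))"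
proof -
  have fin: "finite B" using assms finite_subset by blast
  have "{v \<in> B. \<omega> v = 1} = insert x {v \<in> B - {x}. \<omega> v = 1}" if "\<omega> x = 1" for \<omega> :: "'a \<Rightarrow> nat"
    using that assms(3) by auto
  then have eq: "of_bool (\<omega> x = 1 \<and> Q (colour_count B 1 \<omega>)) =
      (of_bool (\<omega> x = 1 \<and> Q (Suc (colour_count (B - {x}) 1 \<omega>))) :: real)" for \<omega> :: "'a \<Rightarrow> nat"
    using fin by (cases "\<omega> x = 1") auto
  show ?thesis
    unfolding eq
    using single_expect_split[of C x "B - {x}" p "\<lambda>b n. of_bool (b \<and> Q (Suc n))"] assms
      colour_count_binomial[of "C - {x}" "B - {x}" C p "\<lambda>n. of_bool (Q (Suc n))"] fin
    by (auto simp: colour_expect_cmult)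
qed

definition block_cap :: "'a set \<Rightarrow> nat" where
  "block_cap B = (if card B = 5 then 2 else 1)"

text \<open>A block of size \<open>s\<close> with \<open>n\<close> sampled items is kept for at most a \<open>c / n\<close> fraction of the 6 coins
  \<open>u\<close>, where \<open>c\<close> is its capacity, so that on average at most \<open>c\<close> items are kept. A block of size 3 fills its
  group, so one of its sampled items is selected by the greedy phase and not charged.\<close>

definition keep_block :: "nat \<Rightarrow> nat \<Rightarrow> nat \<Rightarrow> bool" where
  "keep_block s u n \<longleftrightarrow> n \<le> 1 \<or> s = 2 \<and> n = 2 \<and> u < 3 \<or> s = 3 \<and> n = 2 \<or>
    s = 5 \<and> (n = 2 \<or> n = 3 \<and> u < 4 \<or> n = 4 \<and> u < 3)"

lemma sum_lessThan_6: "(\<Sum>u<6. h u) = h 0 + h 1 + h 2 + h 3 + h 4 + h (5 :: nat)" for h :: "nat \<Rightarrow> 'b :: comm_monoid_add"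
  by (simp add: eval_nat_numeral)

lemma keep_block_charge:
  assumes "s \<in> {1, 2, 5}" "n \<le> s"
  shows "(\<Sum>u<6. if keep_block s u n then n else 0) \<le> 6 * (if s = 5 then 2 else 1)"
proof -
  have "n \<in> {0, 1, 2, 3, 4, 5}" using assms by auto
  then show ?thesis using assms by (auto simp: keep_block_def sum_lessThan_6)
qed

text \<open>Size 2 attains the bound with equality: a pair sampled together is kept for half of the
  coins. The remaining sizes are compared with it through the linearised powers of
  \<open>p\<close>.\<close>

lemma keep_block_rate:
  fixes p :: real
  defines "p \<equiv> (sqrt 5 - 1) / 4"
  assumes "s \<in> {1, 2, 3, 5}"
  shows "p - p^2/2 \<le> (\<Sum>u<6. 1/6 * (p * binomial_average p (s - 1) (\<lambda>n. of_bool (keep_block s u (Suc n)))))"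
proof -
  note p = golden_power[folded p_def]
  have p4: "p^4 = 1/8 - 3/8 * p"
  proof -
    have "p^4 = p * p^3" by (simp add: eval_nat_numeral)
    also have "\<dots> = p^2/2 - p/8" by (simp add: p(2) power2_eq_square field_simps)
    finally show ?thesis using p(1) by linarith
  qed
  have p5: "p^5 = p/8 - 3/8 * p^2"
  proof -
    have "p^5 = p * p^4" by (simp add: eval_nat_numeral)
    also have "\<dots> = p/8 - 3/8 * p^2" by (simp add: p4 power2_eq_square field_simps)
    finally show ?thesis .
  qed
  consider "s = 1" | "s = 2" | "s = 3" | "s = 5" using assms(2) by auto
  then show ?thesis
  proof cases
    case 1
    then show ?thesis by (simp add: keep_block_def sum_lessThan_6)
  next
    case 2
    then show ?thesis by (simp add: keep_block_def sum_lessThan_6 algebra_simps power2_eq_square)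
  next
    case 3
    have "p - p^2/2 \<le> p - p^3" using p by linarith
    then show ?thesis
      using 3 by (simp add: keep_block_def sum_lessThan_6 eval_nat_numeral algebra_simps)
  next
    case 4
    \<comment> \<open>The coefficients 1, 4, 4, 2 are the binomial coefficients 1, 4, 6, 4 times the
      kept fractions 1, 1, 4/6, 3/6; a fully sampled block is dropped.\<close>
    have "(\<Sum>u<6. 1/6 * (p * binomial_average p (s - 1) (\<lambda>n. of_bool (keep_block s u (Suc n))))) =
        p * ((1 - p)^4 + 4 * p * (1 - p)^3 + 4 * p^2 * (1 - p)^2 + 2 * p^3 * (1 - p))"
      unfolding 4 by (simp add: keep_block_def sum_lessThan_6 eval_nat_numeral) (simp add: field_simps)
    also have "\<dots> = p - 2 * p^3 + 2 * p^4 - p^5"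
      by (simp add: eval_nat_numeral algebra_simps)
    finally show ?thesis using p p4 p5 by linarith
  qed
qed


section \<open>Cutting a group into blocks\<close>

lemma small_block_partition:
  assumes "finite X" "card X \<le> 2 * r"
  shows "\<exists>\<P>. finite \<P> \<and> disjoint \<P> \<and> \<Union>\<P> = X \<and> (\<forall>B\<in>\<P>. card B \<in> {1, 2}) \<and> card \<P> \<le> r"
  using assms
proof (induction r arbitrary: X)
  case 0
  then show ?case by (intro exI[of _ "{}"]) (auto simp: disjoint_def)
next
  case (Suc r)
  show ?case
  proof (cases "card X \<le> 2 * r")
    case True
    then show ?thesis using Suc.IH[OF Suc.prems(1)] by (meson le_SucI)
  next
    case False
    \<comment> \<open>The peeled block takes the excess over \<open>2 * r\<close>, which is 1 or 2
      since \<open>card X \<le> 2 * r + 2\<close>.\<close>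
    then have "card X - 2 * r \<le> card X" "card X - 2 * r \<in> {1, 2}" using Suc.prems by auto
    then obtain Y where Y: "Y \<subseteq> X" "card Y = card X - 2 * r" "card Y \<in> {1, 2}"
      by (metis obtain_subset_with_card_n)
    then have "card (X - Y) \<le> 2 * r"
      using Suc.prems finite_subset by (subst card_Diff_subset) auto
    then obtain \<P> where \<P>: "finite \<P>" "disjoint \<P>" "\<Union>\<P> = X - Y" "\<forall>B\<in>\<P>. card B \<in> {1, 2}" "card \<P> \<le> r"
      using Suc.IH[of "X - Y"] Suc.prems by auto
    have "disjoint (insert Y \<P>)" using \<P>(2,3) unfolding disjoint_def by blast
    moreover have "card (insert Y \<P>) \<le> Suc r" using \<P>(1,5) by (simp add: card_insert_if)
    moreover have "\<Union>(insert Y \<P>) = X" using \<P>(3) Y(1) by auto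
    ultimately show ?thesis using \<P> Y by (intro exI[of _ "insert Y \<P>"]) auto
  qed
qed

text \<open>A single item beyond \<open>2 * r\<close> is absorbed by one block of size 5 that uses
  two units, because \<open>2 * r + 1 = 5 + 2 * (r - 2)\<close>.\<close>

lemma block_partition:
  assumes "finite X" "card X \<le> 2 * r \<or> card X = 2 * r + 1 \<and> 2 \<le> r \<or> card X = 3 \<and> r = 1"
  shows "\<exists>\<P>. finite \<P> \<and> disjoint \<P> \<and> \<Union>\<P> = X \<and> sum block_cap \<P> \<le> r \<and>
    (\<forall>B\<in>\<P>. card B \<in> {1, 2, 5} \<or> card B = 3 \<and> B = X \<and> r = 1)"
proof -
  have small: "\<exists>\<P>. finite \<P> \<and> disjoint \<P> \<and> \<Union>\<P> = Y \<and> (\<forall>B\<in>\<P>. card B \<in> {1, 2}) \<and> sum block_cap \<P> \<le> s"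
    if Y: "finite Y" "card Y \<le> 2 * s" for Y :: "'a set" and s
  proof -
    obtain \<P> where \<P>: "finite \<P>" "disjoint \<P>" "\<Union>\<P> = Y" "\<forall>B\<in>\<P>. card B \<in> {1, 2}" "card \<P> \<le> s"
      using small_block_partition[OF Y] by blast
    have "sum block_cap \<P> = (\<Sum>B\<in>\<P>. 1)" using \<P>(4) by (intro sum.cong) (auto simp: block_cap_def)
    then show ?thesis using \<P> by auto
  qed
  consider "card X \<le> 2 * r" | "card X = 2 * r + 1" "2 \<le> r" | "card X = 3" "r = 1" using assms(2) by auto
  then show ?thesis
  proof cases
    case 1
    obtain \<P> where \<P>: "finite \<P>" "disjoint \<P>" "\<Union>\<P> = X" "\<forall>B\<in>\<P>. card B \<in> {1, 2}" "sum block_cap \<P> \<le> r"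
      using small[OF assms(1) 1] by blast
    then show ?thesis by (intro exI[of _ \<P>]) auto
  next
    case 2
    then have "5 \<le> card X" by simp
    then obtain Y where Y: "Y \<subseteq> X" "card Y = 5" by (metis obtain_subset_with_card_n)
    then have "card (X - Y) \<le> 2 * (r - 2)"
      using 2 assms(1) finite_subset by (subst card_Diff_subset) auto
    then obtain \<P> where \<P>: "finite \<P>" "disjoint \<P>" "\<Union>\<P> = X - Y" "\<forall>B\<in>\<P>. card B \<in> {1, 2}" "sum block_cap \<P> \<le> r - 2"
      using small[of "X - Y" "r - 2"] assms(1) by blast
    have "disjoint (insert Y \<P>)" using \<P>(2,3) unfolding disjoint_def by blast
    moreover have "Y \<notin> \<P>" using \<P>(4) Y(2) by auto
    then have "sum block_cap (insert Y \<P>) \<le> r" using \<P> Y 2 by (simp add: block_cap_def)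
    moreover have "\<Union>(insert Y \<P>) = X" using \<P>(3) Y(1) by auto
    ultimately show ?thesis using \<P> Y by (intro exI[of _ "insert Y \<P>"]) auto
  next
    case 3
    then show ?thesis by (intro exI[of _ "{X}"]) (auto simp: disjoint_def block_cap_def)
  qed
qed

section \<open>Value of the greedy set under blockwise thinning\<close>

context greedy_instance
begin

text \<open>Summed over the six coins, the kept but unselected items of a saturated group number at
  most six times its capacity, so at price \<open>h\<close> they cost on average at most the gains
  of the group. Adding the thinned items thus at most doubles \<open>f (A R)\<close> on average,
  while they cover each item of \<open>C\<close> at rate \<open>p - p^2/2\<close>.\<close>

lemma greedy_value_blocks:
  fixes C :: "'a set"
  defines "p \<equiv> (sqrt 5 - 1) / 4"
  assumes cert: "\<And>R. R \<subseteq> V \<Longrightarrow> certificate R (A R) (\<gamma> R) (h R)" and "C \<subseteq> V"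
    and sizes: "\<And>i. i < m \<Longrightarrow> card (C \<inter> G i) \<le> 2 * cap i \<or>
      card (C \<inter> G i) = 2 * cap i + 1 \<and> 2 \<le> cap i \<or> card (C \<inter> G i) = 3 \<and> cap i = 1 \<and> G i \<subseteq> C"
  shows "9/100 * f C \<le> sample_expect V p (\<lambda>R. f (A R))"
proof -
  note p = golden_power[folded p_def]
  have finC: "finite C" using \<open>C \<subseteq> V\<close> finite_ground by (rule finite_subset)
  have "\<exists>\<P>. finite \<P> \<and> disjoint \<P> \<and> \<Union>\<P> = C \<inter> G i \<and> sum block_cap \<P> \<le> cap i \<and>
    (\<forall>B\<in>\<P>. card B \<in> {1, 2, 5} \<or> card B = 3 \<and> B = C \<inter> G i \<and> cap i = 1)" if "i < m" for i
    using block_partition[of "C \<inter> G i" "cap i"] sizes[OF that] finC by auto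
  then obtain \<P> where \<P>: "\<And>i. i < m \<Longrightarrow> finite (\<P> i) \<and> disjoint (\<P> i) \<and> \<Union>(\<P> i) = C \<inter> G i \<and> sum block_cap (\<P> i) \<le> cap i \<and>
    (\<forall>B\<in>\<P> i. card B \<in> {1, 2, 5} \<or> card B = 3 \<and> B = C \<inter> G i \<and> cap i = 1)"
    by metis
  have unique: "B = B'" if "i < m" "i' < m" "B \<in> \<P> i" "B' \<in> \<P> i'" "v \<in> B" "v \<in> B'" for i i' B B' v
  proof -
    have "v \<in> G i" "v \<in> G i'" using \<P>[OF that(1)] \<P>[OF that(2)] that by blast+
    then have "i = i'" using group_disjoint that by blast
    then show ?thesis using \<P>[OF that(1)] that by (auto dest: disjointD)
  qed
  define q where "q = single_weights C p"
  have q: "colour_weights q W" for W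
    unfolding q_def using p by (intro single_weights_valid) auto
  define Rs where "Rs = colour_sample V 1"
  have Rs: "Rs \<omega> \<subseteq> V" for \<omega> by (auto simp: Rs_def colour_sample_def)
  have AR: "A R \<subseteq> R" if "R \<subseteq> V" for R
    using cert[OF that] by (auto simp: certificate_def greedy_gains_def)
  have marginal: "colour_expect q V (\<lambda>\<omega>. \<phi> (Rs \<omega>)) = sample_expect V p \<phi>" for \<phi>
    unfolding Rs_def using p single_weights_valid(2)[of p C] q
    by (intro colour_expect_sample[OF finite_ground]) (auto simp: q_def)
  define T where "T u \<omega> = {v \<in> C. \<omega> v = 1 \<and> (\<exists>i<m. \<exists>B\<in>\<P> i. v \<in> B \<and> keep_block (card B) u (colour_count B 1 \<omega>))}" for u \<omega>
  define S where "S u \<omega> = A (Rs \<omega>) \<union> T u \<omega>" for u \<omega>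
  define t where "t = p - p^2/2"
  have "0 \<le> t" "t \<le> 1" unfolding t_def using p by linarith+
  have "(1 - p) * t * f C \<le> (\<Sum>u<6. 1/6 * colour_expect q V (\<lambda>\<omega>. f (S u \<omega>)))"
  proof (rule expected_value_bound[where T = T])
    show "T u \<omega> = T u \<omega>'" if eq: "\<And>v. v \<in> C \<Longrightarrow> \<omega> v = \<omega>' v" for u \<omega> \<omega>'
    proof -
      have "colour_count B 1 \<omega> = colour_count B 1 \<omega>'" if "i < m" "B \<in> \<P> i" for B i
      proof -
        have "B \<subseteq> C" using \<P>[OF that(1)] that(2) by blast
        then have "{v \<in> B. \<omega> v = 1} = {v \<in> B. \<omega>' v = 1}"
          by (intro Collect_cong conj_cong refl) (simp add: eq subset_iff)
        then show ?thesis by simp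
      qed
      then show ?thesis unfolding T_def
        by (intro Collect_cong conj_cong ex_cong1 bex_cong refl) (simp_all add: eq)
    qed
    show "T u \<omega> \<subseteq> C \<and> T u \<omega> \<subseteq> S u \<omega> \<and> S u \<omega> \<subseteq> V" for u \<omega>
      using AR[OF Rs] Rs \<open>C \<subseteq> V\<close> unfolding T_def S_def by blast
    show "\<omega> v \<noteq> 0" if "v \<in> S u \<omega> - C" for u \<omega> v
      using that AR[OF Rs, of \<omega>] by (auto simp: T_def S_def Rs_def colour_sample_def)
    show "q v 0 = 1 - p" if "v \<in> V - C" for v using that by (simp add: q_def single_weights_def)
    fix v assume "v \<in> C"
    then obtain i where i: "i < m" "v \<in> C \<inter> G i" using group_exists[of v] \<open>C \<subseteq> V\<close> by blast
    then obtain B where B: "B \<in> \<P> i" "v \<in> B" using \<P>[OF i(1)] by blast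
    then have "B \<subseteq> C" "card B \<in> {1, 2, 3, 5}" using \<P>[OF i(1)] by auto
    have "v \<in> T u \<omega> \<longleftrightarrow> \<omega> v = 1 \<and> keep_block (card B) u (colour_count B 1 \<omega>)" for u \<omega>
      using unique i B \<open>v \<in> C\<close> unfolding T_def by blast
    then have rate: "colour_expect q C (\<lambda>\<omega>. of_bool (v \<in> T u \<omega>)) = p * binomial_average p (card B - 1) (\<lambda>n. of_bool (keep_block (card B) u (Suc n)))" for u
      using block_member_expect[OF finC \<open>B \<subseteq> C\<close> \<open>v \<in> B\<close>, of p "keep_block (card B) u"] p by (simp add: q_def)
    show "t \<le> (\<Sum>u<6. 1/6 * colour_expect q C (\<lambda>\<omega>. of_bool (v \<in> T u \<omega>)))"
      unfolding rate t_def p_def by (rule keep_block_rate) fact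
  qed (use q \<open>C \<subseteq> V\<close> p(3,4) \<open>0 \<le> t\<close> \<open>t \<le> 1\<close> in simp_all)
  also have "\<dots> = colour_expect q V (\<lambda>\<omega>. \<Sum>u<6. 1/6 * f (S u \<omega>))"
    by (simp only: colour_expect_sum colour_expect_cmult)
  also have "\<dots> \<le> colour_expect q V (\<lambda>\<omega>. 2 * f (A (Rs \<omega>)))"
  proof (rule colour_expect_mono_support[OF q _ finite_ground])
    fix \<omega> assume nz: "\<And>v. v \<in> V \<Longrightarrow> q v (\<omega> v) \<noteq> 0"
    have supp: "\<omega> v \<noteq> 4" if "v \<in> C" for v
      using nz[of v] that \<open>C \<subseteq> V\<close> by (auto simp: q_def single_weights_def split: if_splits)
    let ?R = "Rs \<omega>"
    note certR = cert[OF Rs, of \<omega>]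
    have block: "(\<Sum>u<6. card (T u \<omega> \<inter> B - A ?R)) \<le> 6 * block_cap B"
      if i: "i < m" and B: "B \<in> \<P> i" and full: "card (A ?R \<inter> G i) = cap i" for i B
    proof -
      have BC: "B \<subseteq> C \<inter> G i" and finB: "finite B" using \<P>[OF i] B finite_subset[OF _ finC, of B] by auto
      have TB: "T u \<omega> \<inter> B = (if keep_block (card B) u (colour_count B 1 \<omega>) then {v \<in> B. \<omega> v = 1} else {})" for u
      proof -
        have "v \<in> T u \<omega> \<longleftrightarrow> \<omega> v = 1 \<and> keep_block (card B) u (colour_count B 1 \<omega>)" if "v \<in> B" for v
          using unique[OF i _ B _ that] i B BC that unfolding T_def by blast
        then show ?thesis by auto
      qed
      show ?thesis
      proof (cases "card B = 3")
        case False
        have "(\<Sum>u<6. card (T u \<omega> \<inter> B - A ?R)) \<le> (\<Sum>u<6. if keep_block (card B) u (colour_count B 1 \<omega>) then colour_count B 1 \<omega> else 0)"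
          using finB by (intro sum_mono) (auto simp: TB intro!: card_mono)
        also have "\<dots> \<le> 6 * (if card B = 5 then 2 else 1)"
          using \<P>[OF i] B False finB by (intro keep_block_charge) (auto intro: card_mono)
        finally show ?thesis by (simp add: block_cap_def)
      next
        case True
        then have B_eq: "B = C \<inter> G i" "cap i = 1" using \<P>[OF i] B by auto
        \<comment> \<open>A block of size 3 is here the whole group, so the selected item of the
          saturated group lies in it and has colour 1; at most one kept item is left to
          charge.\<close>
        then have "G i \<subseteq> C" using sizes[OF i] True by auto
        then have BG: "B = G i" using B_eq by auto
        have "A ?R \<inter> G i \<noteq> {}" using full B_eq by auto
        then obtain z where z: "z \<in> A ?R" "z \<in> B" using BG by auto
        then have "z \<in> C" "z \<in> ?R" using BC AR[OF Rs] by auto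
        then have "\<omega> z = 1" using supp by (auto simp: Rs_def colour_sample_def)
        then have "card ({v \<in> B. \<omega> v = 1} - A ?R) \<le> card ({v \<in> B. \<omega> v = 1} - {z})"
          using finB z by (intro card_mono) auto
        also have "\<dots> = colour_count B 1 \<omega> - 1" using finB z \<open>\<omega> z = 1\<close> by simp
        finally have "card (T u \<omega> \<inter> B - A ?R) \<le> 1" for u
          using True by (auto simp: TB keep_block_def)
        then have "(\<Sum>u<6. card (T u \<omega> \<inter> B - A ?R)) \<le> (\<Sum>u<6::nat. 1)" by (intro sum_mono)
        then show ?thesis using True by (simp add: block_cap_def)
      qed
    qed
    have group: "(\<Sum>u<6. real (card (T u \<omega> \<inter> G i - A ?R)) * h ?R i) \<le> 6 * sum (\<gamma> ?R) (A ?R \<inter> G i)" if i: "i < m" for i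
    proof -
      have h: "0 \<le> h ?R i" "0 < h ?R i \<longrightarrow> card (A ?R \<inter> G i) = cap i" "real (cap i) * h ?R i \<le> sum (\<gamma> ?R) (A ?R \<inter> G i)"
        using certR i by (auto simp: certificate_def)
      show ?thesis
      proof (cases "h ?R i = 0")
        case True
        then show ?thesis using h by simp
      next
        case False
        then have full: "card (A ?R \<inter> G i) = cap i" using h by simp
        have "(\<Sum>u<6. card (T u \<omega> \<inter> G i - A ?R)) \<le> (\<Sum>u<6. \<Sum>B\<in>\<P> i. card (T u \<omega> \<inter> B - A ?R))"
        proof (intro sum_mono)
          fix u
          have eq: "T u \<omega> \<inter> G i - A ?R = (\<Union>B\<in>\<P> i. T u \<omega> \<inter> B - A ?R)"
            using \<P>[OF i] by (auto simp: T_def)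
          show "card (T u \<omega> \<inter> G i - A ?R) \<le> (\<Sum>B\<in>\<P> i. card (T u \<omega> \<inter> B - A ?R))"
            unfolding eq using \<P>[OF i] by (intro card_UN_le) simp
        qed
        also have "\<dots> = (\<Sum>B\<in>\<P> i. \<Sum>u<6. card (T u \<omega> \<inter> B - A ?R))" by (rule sum.swap)
        also have "\<dots> \<le> (\<Sum>B\<in>\<P> i. 6 * block_cap B)" by (intro sum_mono block[OF i _ full])
        also have "\<dots> \<le> 6 * cap i" using \<P>[OF i] by (simp flip: sum_distrib_left)
        finally have "real (\<Sum>u<6. card (T u \<omega> \<inter> G i - A ?R)) \<le> real (6 * cap i)" by (simp only: of_nat_le_iff)
        then have "real (\<Sum>u<6. card (T u \<omega> \<inter> G i - A ?R)) * h ?R i \<le> real (6 * cap i) * h ?R i"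
          using h(1) by (rule mult_right_mono)
        then show ?thesis using h(3) by (simp add: sum_distrib_right mult.assoc)
      qed
    qed
    have "(\<Sum>u<6. 1/6 * f (S u \<omega>)) \<le> (\<Sum>u<6. 1/6 * (f (A ?R) + (\<Sum>i<m. real (card (T u \<omega> \<inter> G i - A ?R)) * h ?R i)))"
    proof (intro sum_mono mult_left_mono)
      fix u
      have "T u \<omega> \<subseteq> ?R" using \<open>C \<subseteq> V\<close> by (auto simp: T_def Rs_def colour_sample_def)
      then show "f (S u \<omega>) \<le> f (A ?R) + (\<Sum>i<m. real (card (T u \<omega> \<inter> G i - A ?R)) * h ?R i)"
        unfolding S_def using AR[OF Rs, of \<omega>] Rs[of \<omega>] by (intro union_le_charges[OF certR Rs]) auto
    qed auto
    also have "\<dots> = f (A ?R) + 1/6 * (\<Sum>i<m. \<Sum>u<6. real (card (T u \<omega> \<inter> G i - A ?R)) * h ?R i)"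
      by (simp add: sum_distrib_left distrib_left sum.distrib sum.swap[of _ "{..<m}"])
    also have "\<dots> \<le> f (A ?R) + 1/6 * (\<Sum>i<m. 6 * sum (\<gamma> ?R) (A ?R \<inter> G i))"
      by (intro add_left_mono mult_left_mono sum_mono group) auto
    also have "\<dots> = f (A ?R) + (f (A ?R) - f {})"
      using certificate_gain[OF certR Rs] by (simp flip: sum_distrib_left)
    also have "\<dots> \<le> 2 * f (A ?R)" using nonneg[of "{}"] by simp
    finally show "(\<Sum>u<6. 1/6 * f (S u \<omega>)) \<le> 2 * f (A ?R)" .
  qed
  also have "\<dots> = 2 * sample_expect V p (\<lambda>R. f (A R))"
    by (simp only: colour_expect_cmult marginal[of "\<lambda>R. f (A R)"])
  finally have main: "(1 - p) * t * f C \<le> 2 * sample_expect V p (\<lambda>R. f (A R))" .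
  \<comment> \<open>\<open>18/100\<close> is twice the target \<open>9/100\<close>, matching the
    factor 2 above. The right side is about 0.1805, so the margin is small.\<close>
  have "18/100 \<le> (1 - p) * t"
  proof -
    have "(1 - p) * t = p - 3/2 * p^2 + 1/2 * p^3"
      by (simp add: t_def field_simps power2_eq_square power3_eq_cube)
    then show ?thesis using p by linarith
  qed
  then have "18/100 * f C \<le> (1 - p) * t * f C"
    using nonneg[OF \<open>C \<subseteq> V\<close>] by (intro mult_right_mono)
  then have "18/100 * f C \<le> 2 * sample_expect V p (\<lambda>R. f (A R))" using main by (rule order_trans)
  then show ?thesis by simp
qed

text \<open>Fairness bounds \<open>card (C \<inter> G i)\<close> by \<open>card (G i)\<close> and by
  \<open>kmin m G + \<alpha>\<close>, hence by \<open>2 * cap i + 1\<close>, so only an excess of 1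
  over twice the capacity can occur. It is harmful only for capacity 1 in a group not contained in
  \<open>C\<close>, and one such group forces all groups into the same shape.\<close>

lemma fair_group_sizes:
  assumes "C \<subseteq> V" "fair_feasible m G \<alpha> C"
  shows "(\<forall>i<m. card (C \<inter> G i) = 3 \<and> cap i = 1) \<or>
    (\<forall>i<m. card (C \<inter> G i) \<le> 2 * cap i \<or>
      card (C \<inter> G i) = 2 * cap i + 1 \<and> 2 \<le> cap i \<or> card (C \<inter> G i) = 3 \<and> cap i = 1 \<and> G i \<subseteq> C)"
proof (cases "\<exists>i<m. card (C \<inter> G i) = 3 \<and> cap i = 1 \<and> \<not> G i \<subseteq> C")
  case fin: False
  have "kmin m G \<in> (\<lambda>i. card (G i)) ` {..<m}"
    unfolding kmin_def using groups by (intro Min_in) (auto simp: lessThan_empty_iff)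
  then obtain j where j: "j < m" "kmin m G = card (G j)" by auto
  have le: "card (C \<inter> G i) \<le> card (G i)" if "i < m" for i
    using finite_subset[OF group_subset[OF that] finite_ground] by (intro card_mono) auto
  have bound: "card (C \<inter> G i) \<le> 2 * cap i + 1" if i: "i < m" for i
  proof -
    have "card (C \<inter> G i) \<le> card (C \<inter> G j) + \<alpha>"
      using assms(2) i j(1) unfolding fair_feasible_def by fastforce
    then have "card (C \<inter> G i) \<le> kmin m G + \<alpha>" using le[OF j(1)] j(2) by simp
    then show ?thesis using le[OF i] unfolding rcap_def by (auto simp: min_def)
  qed
  show ?thesis
  proof (rule disjI2, intro allI impI)
    fix i assume i: "i < m"
    show "card (C \<inter> G i) \<le> 2 * cap i \<or>
      card (C \<inter> G i) = 2 * cap i + 1 \<and> 2 \<le> cap i \<or> card (C \<inter> G i) = 3 \<and> cap i = 1 \<and> G i \<subseteq> C"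
    proof (cases "cap i = 1")
      case True
      then show ?thesis using bound[OF i] fin i by (cases "card (C \<inter> G i) \<le> 2") auto
    next
      case False
      then show ?thesis using bound[OF i] cap_pos[OF i] by linarith
    qed
  qed
next
  case True
  then obtain i where i: "i < m" "card (C \<inter> G i) = 3" "cap i = 1" "\<not> G i \<subseteq> C" by blast
  have "kmin m G \<in> (\<lambda>i. card (G i)) ` {..<m}"
    unfolding kmin_def using groups by (intro Min_in) (auto simp: lessThan_empty_iff)
  then obtain j where j: "j < m" "kmin m G = card (G j)" by auto
  have fin: "finite (G k)" if "k < m" for k using finite_subset[OF group_subset[OF that] finite_ground] .
  have le: "card (C \<inter> G k) \<le> card (G k)" if "k < m" for k using fin[OF that] by (intro card_mono) auto
  have "C \<inter> G i \<subset> G i" using i(4) by auto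
  then have "3 < card (G i)" using psubset_card_mono[OF fin[OF i(1)]] i(2) by metis
  \<comment> \<open>With at least four items in the group, its capacity 1 comes from
    \<open>kmin m G div 2 + \<alpha>\<close>; as \<open>kmin m G div 2\<close> is already positive,
    \<open>\<alpha> = 0\<close> follows.\<close>
  then have "kmin m G div 2 + \<alpha> = 1" using i(3) unfolding rcap_def by (auto simp: min_def split: if_splits)
  then have \<alpha>: "\<alpha> = 0" "kmin m G \<le> 3" using kmin_gt_1 by linarith+
  \<comment> \<open>With \<open>\<alpha> = 0\<close> fairness means equal counts in all
    groups.\<close>
  have eq: "card (C \<inter> G k) = card (C \<inter> G k')" if "k < m" "k' < m" for k k'
    using assms(2) that \<alpha>(1) unfolding fair_feasible_def by (auto intro!: antisym)
  then have three: "card (C \<inter> G k) = 3" if "k < m" for k using i(1,2) that by metis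
  have "cap k = 1" if "k < m" for k
  proof -
    have "3 \<le> card (G k)" using le[OF that] three[OF that] by simp
    moreover have "kmin m G div 2 = 1" using kmin_gt_1 \<alpha>(2) by linarith
    ultimately show ?thesis using \<alpha>(1) by (simp add: rcap_def)
  qed
  then show ?thesis using three by blast
qed

end

theorem theorem1:
  fixes V :: "'a set" and m :: nat and G :: "nat \<Rightarrow> 'a set" and \<alpha> :: nat
    and f :: "'a set \<Rightarrow> real" and OPT :: "'a set" and out :: "'a set \<Rightarrow> 'a set"
  assumes "finite V" and "m \<ge> 1" and "is_partition V m G"
    and "\<forall>S\<subseteq>V. f S \<ge> 0" and "submodular_on V f"
    and "OPT \<subseteq> V" and "fair_feasible m G \<alpha> OPT"
    and "\<forall>S\<subseteq>V. fair_feasible m G \<alpha> S \<longrightarrow> f S \<le> f OPT"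
    and "kmin m G > 1"
    and "\<forall>R\<subseteq>V. SG_output m G \<alpha> f R (out R)"
  shows "sample_expect V ((sqrt 5 - 1) / 4) (\<lambda>R. f (out R)) \<ge> 0.045 * f OPT"
proof -
  interpret greedy_instance V f m G \<alpha> using assms by unfold_locales auto
  \<comment> \<open>For each sample a greedy set behind the given output is chosen, so ties and
    completions may depend on \<open>R\<close> in any way.\<close>
  have "\<exists>A \<gamma> h. certificate R A \<gamma> h \<and> f A \<le> 2 * f (out R)" if "R \<subseteq> V" for R
    using completion_loses_half[of R "out R"] greedy_result_certificate[of R] assms(10) that by meson
  then obtain A \<gamma> h where cert: "\<And>R. R \<subseteq> V \<Longrightarrow> certificate R (A R) (\<gamma> R) (h R)"
    and half: "\<And>R. R \<subseteq> V \<Longrightarrow> f (A R) \<le> 2 * f (out R)"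
    by metis
  let ?p = "(sqrt 5 - 1) / 4 :: real"
  have "9/100 * f OPT \<le> sample_expect V ?p (\<lambda>R. f (A R))"
    using fair_group_sizes[OF assms(6,7)]
  proof
    assume "\<forall>i<m. card (OPT \<inter> G i) = 3 \<and> cap i = 1"
    then show ?thesis using assms(6) by (intro greedy_value_three_copies[OF cert]) auto
  next
    assume "\<forall>i<m. card (OPT \<inter> G i) \<le> 2 * cap i \<or>
      card (OPT \<inter> G i) = 2 * cap i + 1 \<and> 2 \<le> cap i \<or> card (OPT \<inter> G i) = 3 \<and> cap i = 1 \<and> G i \<subseteq> OPT"
    then show ?thesis using assms(6) by (intro greedy_value_blocks[OF cert]) blast+
  qed
  also have "\<dots> \<le> sample_expect V ?p (\<lambda>R. 2 * f (out R))"
    using golden_power(3,4) half by (intro sample_expect_mono) auto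
  also have "\<dots> = 2 * sample_expect V ?p (\<lambda>R. f (out R))"
    by (simp add: sample_expect_def sum_distrib_left mult.left_commute)
  finally show ?thesis by simp
qed

end
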